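(* Let $K$ be a field with algebraic closure $\overline{K}$ and with a non-archimedean absolute value $|\cdot|_v$ on $\overline{K}$. Let $\phi\in K(z)$ be a rational function of degree $d\geq 2$. Let $x_1,\ldots,x_{d+1}\in\mathbb{P}^1(\overline{K})$ be the fixed points of $\phi$, repeated according to multiplicity. If any $x_i$ is repelling, then $\phi$ does not have potentially good reduction. Otherwise (no $x_i$ is repelling), define $h\in\mathrm{PGL}(2,\overline{K})$ as follows. (1) If $x_i$ is indifferent for some $i$, then it is possible to choose $y_1\in\phi^{-1}(x_i)\smallsetminus\{x_i\}$ and $y_2\in\phi^{-1}(y_1)$ (preimages taken in $\mathbb{P}^1(\overline{K})$). For any such $i$ and any such choice, the three points $x_i,y_1,y_2\in\mathbb{P}^1(\overline{K})$ are necessarily distinct, and so there is a unique $h\in\mathrm{PGL}(2,\overline{K})$ such that $h(x_i)=0$, $h(y_1)=1$, and $h(y_2)=\infty$. (2) Otherwise, all the fixed points are attracting, and $x_1$, $x_2$, $x_3$ are necessarily distinct. Thus there is a unique $h\in\mathrm{PGL}(2,\overline{K})$ such that $h(x_1)=0$, $h(x_2)=1$, and $h(x_3)=\infty$. Let $\psi=h\circ\phi\circ h^{-1}\in\overline{K}(z)$. Then $\phi$ has potentially good reduction if and only if $\psi$ has good reduction; in that case, $h$ provides the desired coordinate change (i.e., $h\circ\phi\circ h^{-1}$ has good reduction).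
   Context: Rational functions act on $\mathbb{P}^1(\overline{K})=\overline{K}\cup\{\infty\}$, and $\mathrm{PGL}(2,\overline{K})$ acts by linear fractional transformations. The degree of $\phi=f/g$, with $f,g$ polynomials having no common factors, is $\deg\phi:=\max\{\deg f,\deg g\}$. Fixed points and multipliers: a rational function $\phi$ of degree $d\ge 2$ has exactly $d+1$ fixed points in $\mathbb{P}^1(\overline{K})$ counted with multiplicity (the multiplicity of a fixed point $x\in\overline{K}$ is the order of vanishing of $\phi(z)-z$ at $z=x$; the multiplicity of a fixed point at $\infty$ is the multiplicity of $0$ as a fixed point of $1/\phi(1/z)$). The multiplier of a fixed point $x$ is $\lambda:=\phi'(x)$ if $x\in\overline{K}$, and $\lambda:=\psi'(0)$ with $\psi(z)=1/\phi(1/z)$ if $x=\infty$. The fixed point $x$ is repelling if $|\lambda|_v>1$, indifferent if $|\lambda|_v=1$, and attracting if $|\lambda|_v<1$. Reduction: let $L$ be $K$ or $\overline{K}$, let $\mathcal{O}_L=\{x\in L:|x|_v\le 1\}$ be its ring of integers, and let $\mathcal{M}_L=\{x\in L:|x|_v<1\}$ be its maximal ideal. For $f\in\mathcal{O}_L[z]$, let $\overline{f}$ denote the polynomial over the residue field obtained by reducing all coefficients modulo $\mathcal{M}_L$. Given $\phi\in L(z)$ of degree at least $1$, write $\phi=f/g$ with $f,g\in\mathcal{O}_L[z]$ having no common factors in $L[z]$ and with at least one coefficient of $f$ or $g$ having absolute value $1$; set $\overline{\phi}:=\overline{f}/\overline{g}$ (whose degree is computed after cancelling common factors of $\overline f$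 and $\overline g$; if $\overline g=0$ then $\overline\phi$ is the constant $\infty$, of degree $0$). Then $\phi$ has good reduction if $\deg\overline{\phi}=\deg\phi$; this does not depend on the choice of $f,g$. The map $\phi$ has potentially good reduction if there is some $h\in\mathrm{PGL}(2,\overline{K})$ such that $h\circ\phi\circ h^{-1}\in\overline{K}(z)$ has good reduction. *)

theory Defs
  imports
    "HOL-Analysis.Determinants"
    "HOL-Computational_Algebra.Polynomial_Factorial"
begin

section \<open>Fields with a non-archimedean absolute value\<close>

text \<open>
  The absolute value is a parameter of a type class, so that the residue field can be a type of
  its own. The trivial absolute value is allowed.
\<close>

class nonarch_field = field +
  fixes absv :: "'a \<Rightarrow> real"
  assumes absv_nonneg: "absv x \<ge> 0"
    and absv_eq_0_iff: "absv x = 0 \<longleftrightarrow> x = 0"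
    and absv_mult: "absv (x * y) = absv x * absv y"
    and absv_add_le_max: "absv (x + y) \<le> max (absv x) (absv y)"

lemma absv_0 [simp]: "absv (0 :: 'a::nonarch_field) = 0"
  by (simp add: absv_eq_0_iff)

lemma absv_1 [simp]: "absv (1 :: 'a::nonarch_field) = 1"
  using absv_mult[of "1::'a" 1] absv_eq_0_iff[of "1::'a"] by simp

lemma absv_minus [simp]: "absv (- x :: 'a::nonarch_field) = absv x"
proof -
  have "(absv (- 1 :: 'a))\<^sup>2 = 1"
    using absv_mult[of "- 1 :: 'a" "- 1"] by (simp add: power2_eq_square)
  hence "absv (- 1 :: 'a) = 1"
    using absv_nonneg[of "- 1 :: 'a"] by (auto simp: power2_eq_1_iff)
  thus ?thesis
    using absv_mult[of "- 1" x] by simp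
qed

lemma absv_diff_le_max: "absv (x - y) \<le> max (absv x) (absv y)"
  using absv_add_le_max[of x "- y"] by simp

lemma absv_diff_commute: "absv (x - y :: 'a::nonarch_field) = absv (y - x)"
  using absv_minus[of "x - y"] unfolding minus_diff_eq by (rule sym)

lemma absv_inverse: "absv (inverse x) = inverse (absv x)"
proof (cases "x = 0")
  case False
  hence "absv x * absv (inverse x) = 1"
    using absv_mult[of x "inverse x"] by simp
  thus ?thesis
    by (metis inverse_unique)
qed simp

definition residue_rel :: "'a::nonarch_field \<Rightarrow> 'a \<Rightarrow> bool"
  where "residue_rel x y \<longleftrightarrow> absv x \<le> 1 \<and> absv y \<le> 1 \<and> absv (x - y) < 1"

lemma residue_rel_diffI:
  assumes "absv x \<le> 1" "absv y \<le> 1" "x - y = a + b" "absv a < 1" "absv b < 1"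
  shows "residue_rel x y"
  using assms absv_add_le_max[of a b] by (auto simp: residue_rel_def)

lemma absv_add_le_1: "absv x \<le> 1 \<Longrightarrow> absv y \<le> 1 \<Longrightarrow> absv (x + y) \<le> 1"
  using absv_add_le_max[of x y] by simp

lemma absv_mult_le_1: "absv x \<le> 1 \<Longrightarrow> absv y \<le> 1 \<Longrightarrow> absv (x * y) \<le> 1"
  by (simp add: absv_mult mult_le_one absv_nonneg)

lemma absv_mult_less_1: "absv x \<le> 1 \<Longrightarrow> absv y < 1 \<Longrightarrow> absv (x * y) < 1"
  unfolding absv_mult
  using mult_right_mono[of "absv x" 1 "absv y"] absv_nonneg[of y] by linarith

lemma part_equivp_residue_rel: "part_equivp (residue_rel :: 'a::nonarch_field \<Rightarrow> _)"
proof (rule part_equivpI)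
  show "\<exists>x::'a. residue_rel x x"
    by (rule exI[of _ 0]) (simp add: residue_rel_def)
  show "symp (residue_rel :: 'a \<Rightarrow> _)"
  proof (rule sympI)
    fix x y :: 'a assume "residue_rel x y"
    thus "residue_rel y x"
      unfolding residue_rel_def absv_diff_commute[of y x] by simp
  qed
  show "transp (residue_rel :: 'a \<Rightarrow> _)"
  proof (rule transpI)
    fix x y z :: 'a assume "residue_rel x y" "residue_rel y z"
    thus "residue_rel x z"
      by (intro residue_rel_diffI[of _ _ "x - y" "y - z"]) (auto simp: residue_rel_def algebra_simps)
  qed
qed

section \<open>The residue field\<close>

quotient_type (overloaded) 'a residue = "'a::nonarch_field" / partial: "residue_rel"
  by (rule part_equivp_residue_rel)

instantiation residue :: (nonarch_field) field
begin

lift_definition zero_residue :: "'a residue" is 0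
  by (simp add: residue_rel_def)

lift_definition one_residue :: "'a residue" is 1
  by (simp add: residue_rel_def)

lift_definition plus_residue :: "'a residue \<Rightarrow> 'a residue \<Rightarrow> 'a residue" is "(+)"
proof -
  fix x x' y y' :: 'a
  assume "residue_rel x x'" "residue_rel y y'"
  thus "residue_rel (x + y) (x' + y')"
    using absv_add_le_max[of x y] absv_add_le_max[of x' y']
    by (intro residue_rel_diffI[of _ _ "x - x'" "y - y'"]) (auto simp: residue_rel_def)
qed

lift_definition uminus_residue :: "'a residue \<Rightarrow> 'a residue" is "uminus"
proof -
  fix x y :: 'a
  assume "residue_rel x y"
  moreover have "absv (- x - (- y)) = absv (x - y)"
    using absv_diff_commute[of y x] by simp
  ultimately show "residue_rel (- x) (- y)"
    by (simp add: residue_rel_def)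
qed

lift_definition minus_residue :: "'a residue \<Rightarrow> 'a residue \<Rightarrow> 'a residue" is "(-)"
proof -
  fix x x' y y' :: 'a
  assume "residue_rel x x'" "residue_rel y y'"
  thus "residue_rel (x - y) (x' - y')"
    using absv_diff_le_max[of x y] absv_diff_le_max[of x' y']
      absv_diff_commute[of y y']
    by (intro residue_rel_diffI[of _ _ "x - x'" "y' - y"]) (auto simp: residue_rel_def)
qed

lift_definition times_residue :: "'a residue \<Rightarrow> 'a residue \<Rightarrow> 'a residue" is "(*)"
proof -
  fix x x' y y' :: 'a
  assume *: "residue_rel x x'" "residue_rel y y'"
  have "absv (x * (y - y')) < 1" "absv (y' * (x - x')) < 1"
    using * by (auto intro!: absv_mult_less_1 simp: residue_rel_def)
  thus "residue_rel (x * y) (x' * y')"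
    using *
    by (intro residue_rel_diffI[of _ _ "x * (y - y')" "y' * (x - x')"])
      (auto simp: residue_rel_def algebra_simps intro!: absv_mult_le_1)
qed

lift_definition inverse_residue :: "'a residue \<Rightarrow> 'a residue"
  is "\<lambda>x. if absv x < 1 then 0 else inverse x"
proof -
  fix x x' :: 'a
  assume *: "residue_rel x x'"
  have lt: "absv x < 1 \<longleftrightarrow> absv x' < 1"
    using * absv_add_le_max[of x' "x - x'"] absv_diff_le_max[of x "x - x'"]
    by (auto simp: residue_rel_def)
  show "residue_rel (if absv x < 1 then 0 else inverse x) (if absv x' < 1 then 0 else inverse x')"
  proof (cases "absv x < 1")
    case True
    thus ?thesis using lt by (simp add: residue_rel_def)
  next
    case False
    hence 1: "absv x = 1" "absv x' = 1"
      using * lt by (auto simp: residue_rel_def)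
    hence "x \<noteq> 0" "x' \<noteq> 0" by auto
    hence "inverse x - inverse x' = - (inverse x * inverse x' * (x - x'))"
      by (simp add: field_simps)
    hence "absv (inverse x - inverse x') = absv (x - x')"
      using 1 by (simp add: absv_mult absv_inverse)
    thus ?thesis using * 1 lt by (simp add: residue_rel_def absv_inverse)
  qed
qed

definition divide_residue :: "'a residue \<Rightarrow> 'a residue \<Rightarrow> 'a residue"
  where "divide_residue x y = x * inverse y"

instance
proof
  fix a b c :: "'a residue"
  show "a + b + c = a + (b + c)"
    by transfer (auto simp: residue_rel_def add.assoc intro!: absv_add_le_1)
  show "a + b = b + a"
    by transfer (auto simp: residue_rel_def add.commute intro!: absv_add_le_1)
  show "0 + a = a"
    by transfer (auto simp: residue_rel_def)
  show "- a + a = 0"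
    by transfer (auto simp: residue_rel_def)
  show "a - b = a + - b"
    by transfer (auto simp: residue_rel_def intro: order_trans[OF absv_diff_le_max])
  show "a * b * c = a * (b * c)"
    by transfer (auto simp: residue_rel_def mult.assoc intro!: absv_mult_le_1)
  show "a * b = b * a"
    by transfer (auto simp: residue_rel_def mult.commute intro!: absv_mult_le_1)
  show "1 * a = a"
    by transfer (auto simp: residue_rel_def)
  show "(a + b) * c = a * c + b * c"
  proof transfer
    fix a b c :: 'a
    assume *: "residue_rel a a" "residue_rel b b" "residue_rel c c"
    have "absv ((a + b) * c) \<le> 1"
      using * absv_add_le_max[of a b] by (intro absv_mult_le_1) (auto simp: residue_rel_def)
    thus "residue_rel ((a + b) * c) (a * c + b * c)"
      by (simp add: residue_rel_def distrib_right)
  qed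
  show "(0 :: 'a residue) \<noteq> 1"
    by transfer (simp add: residue_rel_def)
  show "a \<noteq> 0 \<Longrightarrow> inverse a * a = 1"
  proof transfer
    fix a :: 'a
    assume *: "residue_rel a a" "\<not> residue_rel a 0"
    hence "absv a = 1" by (auto simp: residue_rel_def)
    moreover from this have "a \<noteq> 0" by auto
    ultimately show "residue_rel ((if absv a < 1 then 0 else inverse a) * a) 1"
      by (simp add: residue_rel_def)
  qed
  show "a div b = a * inverse b"
    by (rule divide_residue_def)
  show "inverse (0 :: 'a residue) = 0"
    by transfer (simp add: residue_rel_def)
qed

end

definition integral_poly :: "'a::nonarch_field poly \<Rightarrow> bool"
  where "integral_poly f \<longleftrightarrow> (\<forall>i. absv (coeff f i) \<le> 1)"

text \<open>
  Meaningful for integral polynomials only: \<^const>\<open>abs_residue\<close> is unspecified outside of the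
  ring of integers.
\<close>

definition reduce_poly :: "'a::nonarch_field poly \<Rightarrow> 'a residue poly"
  where "reduce_poly = map_poly abs_residue"


section \<open>Rational functions\<close>

text \<open>A rational function over a field is an element of the type \<open>'a poly fract\<close>.\<close>

definition is_quot :: "'a::field poly fract \<Rightarrow> 'a poly \<Rightarrow> 'a poly \<Rightarrow> bool"
  where "is_quot \<phi> f g \<longleftrightarrow> coprime f g \<and> g \<noteq> 0 \<and> \<phi> = to_fract f / to_fract g"

lemma is_quot_exists: "\<exists>f g. is_quot \<phi> f g"
proof -
  define P where "P = (\<lambda>(f, g). g \<noteq> 0 \<and> \<phi> = to_fract f / to_fract g)"
  have "\<exists>fg. P fg"
    by (cases \<phi>) (auto simp: P_def Fract_conv_to_fract)
  then obtain fg where fg: "P fg" and min: "\<And>y. P y \<Longrightarrow> degree (snd fg) \<le> degree (snd y)"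
    using ex_has_least_nat[of P _ "\<lambda>y. degree (snd y)"] by blast
  obtain f g where fg_eq: "fg = (f, g)" by force
  have g: "g \<noteq> 0" "\<phi> = to_fract f / to_fract g"
    using fg by (auto simp: P_def fg_eq)
  have "coprime f g"
  proof (rule coprimeI)
    fix c assume "c dvd f" "c dvd g"
    then obtain f' g' where f': "f = c * f'" and g': "g = c * g'" by (auto elim!: dvdE)
    have nz: "c \<noteq> 0" "g' \<noteq> 0" using g g' by auto
    have "P (f', g')"
      using g nz by (auto simp: P_def f' g' to_fract_mult)
    from min[OF this] have "degree c = 0"
      using nz by (simp add: fg_eq g' degree_mult_eq)
    thus "is_unit c" using nz by (simp add: is_unit_iff_degree)
  qed
  with g show ?thesis by (auto simp: is_quot_def)
qed

definition rat_repr :: "'a::field poly fract \<Rightarrow> 'a poly \<times> 'a poly"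
  where "rat_repr \<phi> = (SOME (f, g). is_quot \<phi> f g)"

definition rat_num :: "'a::field poly fract \<Rightarrow> 'a poly"
  where "rat_num \<phi> = fst (rat_repr \<phi>)"

definition rat_den :: "'a::field poly fract \<Rightarrow> 'a poly"
  where "rat_den \<phi> = snd (rat_repr \<phi>)"

lemma is_quot_rat_num_den: "is_quot \<phi> (rat_num \<phi>) (rat_den \<phi>)"
  unfolding rat_num_def rat_den_def rat_repr_def case_prod_unfold
  by (rule someI_ex[of "\<lambda>p. is_quot \<phi> (fst p) (snd p)"]) (use is_quot_exists[of \<phi>] in auto)

definition rat_degree :: "'a::field poly fract \<Rightarrow> nat"
  where "rat_degree \<phi> = max (degree (rat_num \<phi>)) (degree (rat_den \<phi>))"

definition rat_X :: "'a::field poly fract"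
  where "rat_X = to_fract [:0, 1:]"

definition rat_map :: "('k::field \<Rightarrow> 'a::field) \<Rightarrow> 'k poly fract \<Rightarrow> 'a poly fract"
  where "rat_map \<iota> \<phi> = to_fract (map_poly \<iota> (rat_num \<phi>)) / to_fract (map_poly \<iota> (rat_den \<phi>))"

definition poly_at_rat :: "'a::field poly \<Rightarrow> 'a poly fract \<Rightarrow> 'a poly fract"
  where "poly_at_rat f \<psi> = poly (map_poly (\<lambda>c. to_fract [:c:]) f) \<psi>"

text \<open>
  Composition is only meaningful if the inner function \<open>\<psi>\<close> is not constant: a constant
  \<open>\<psi>\<close> may be a pole of \<open>\<phi>\<close>, and the constant \<open>\<infinity>\<close> is not an element of \<open>'a poly fract\<close>.
\<close>

definition rat_comp :: "'a::field poly fract \<Rightarrow> 'a poly fract \<Rightarrow> 'a poly fract"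
  where "rat_comp \<phi> \<psi> = poly_at_rat (rat_num \<phi>) \<psi> / poly_at_rat (rat_den \<phi>) \<psi>"

definition rat_deriv :: "'a::field poly fract \<Rightarrow> 'a poly fract"
  where "rat_deriv \<phi> =
    to_fract (pderiv (rat_num \<phi>) * rat_den \<phi> - rat_num \<phi> * pderiv (rat_den \<phi>))
      / to_fract ((rat_den \<phi>)\<^sup>2)"

text \<open>The value at a point that is not a pole.\<close>

definition rat_value :: "'a::field poly fract \<Rightarrow> 'a \<Rightarrow> 'a"
  where "rat_value \<phi> a = poly (rat_num \<phi>) a / poly (rat_den \<phi>) a"

text \<open>The order of vanishing at a point, negative at poles.\<close>

definition rat_order :: "'a::field \<Rightarrow> 'a poly fract \<Rightarrow> int"
  where "rat_order a \<phi> = int (order a (rat_num \<phi>)) - int (order a (rat_den \<phi>))"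


section \<open>The projective line and \<open>PGL\<^sub>2\<close>\<close>

datatype 'a proj_line = Aff 'a | Infty

text \<open>
  In homogeneous coordinates \<open>\<phi>([X : Y]) = [F(X, Y) : G(X, Y)]\<close>, where \<open>F\<close> and \<open>G\<close> are the
  homogenizations of numerator and denominator to degree \<open>d = deg \<phi>\<close>. At \<open>[1 : 0]\<close> this gives
  the coefficients of index \<open>d\<close>.
\<close>

definition rat_apply :: "'a::field poly fract \<Rightarrow> 'a proj_line \<Rightarrow> 'a proj_line"
  where "rat_apply \<phi> p = (case p of
      Aff a \<Rightarrow>
        if poly (rat_den \<phi>) a = 0 then Infty else Aff (poly (rat_num \<phi>) a / poly (rat_den \<phi>) a)
    | Infty \<Rightarrow>
        let d = rat_degree \<phi> in
        if coeff (rat_den \<phi>) d = 0 then Infty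
        else Aff (coeff (rat_num \<phi>) d / coeff (rat_den \<phi>) d))"

definition scale_matrix :: "'a::field \<Rightarrow> 'a^2^2 \<Rightarrow> 'a^2^2"
  where "scale_matrix c A = (\<chi> i j. c * A $ i $ j)"

definition pgl_rel :: "'a::field^2^2 \<Rightarrow> 'a^2^2 \<Rightarrow> bool"
  where "pgl_rel A B \<longleftrightarrow> invertible A \<and> invertible B \<and> (\<exists>c. c \<noteq> 0 \<and> B = scale_matrix c A)"

lemma part_equivp_pgl_rel: "part_equivp (pgl_rel :: 'a::field^2^2 \<Rightarrow> _)"
proof (rule part_equivpI)
  have "invertible (mat 1 :: 'a^2^2)"
    unfolding invertible_def by (auto intro: exI[of _ "mat 1"])
  moreover have "mat 1 = scale_matrix 1 (mat 1 :: 'a^2^2)"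
    by (simp add: scale_matrix_def vec_eq_iff)
  ultimately show "\<exists>A :: 'a^2^2. pgl_rel A A"
    unfolding pgl_rel_def by (intro exI[of _ "mat 1"] conjI exI[of _ 1]) auto
  show "symp (pgl_rel :: 'a^2^2 \<Rightarrow> _)"
  proof (rule sympI)
    fix A B :: "'a^2^2" assume "pgl_rel A B"
    then obtain c where "invertible A" "invertible B" "c \<noteq> 0" "B = scale_matrix c A"
      by (auto simp: pgl_rel_def)
    moreover from this have "A = scale_matrix (inverse c) B"
      by (simp add: scale_matrix_def vec_eq_iff)
    ultimately show "pgl_rel B A"
      unfolding pgl_rel_def by (metis nonzero_imp_inverse_nonzero)
  qed
  show "transp (pgl_rel :: 'a^2^2 \<Rightarrow> _)"
  proof (rule transpI)
    fix A B C :: "'a^2^2" assume "pgl_rel A B" "pgl_rel B C"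
    then obtain c d where *: "invertible A" "invertible C" "c \<noteq> 0" "B = scale_matrix c A"
        "d \<noteq> 0" "C = scale_matrix d B"
      by (auto simp: pgl_rel_def)
    hence "C = scale_matrix (d * c) A"
      by (simp add: scale_matrix_def vec_eq_iff mult.assoc)
    with * show "pgl_rel A C"
      unfolding pgl_rel_def by (metis mult_eq_0_iff)
  qed
qed

quotient_type (overloaded) 'a pgl2 = "'a::field^2^2" / partial: pgl_rel
  by (rule part_equivp_pgl_rel)

lemma matrix_inv_eqI:
  assumes "(A::'a::field^'n^'n) ** B = mat 1"
  shows "matrix_inv A = B"
proof -
  have BA: "B ** A = mat 1"
    by (rule iffD1[OF matrix_left_right_inverse assms])
  have "A ** matrix_inv A = mat 1 \<and> matrix_inv A ** A = mat 1"
    unfolding matrix_inv_def by (rule someI[of _ B]) (intro conjI assms BA)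
  hence "B ** (A ** matrix_inv A) = B"
    by (simp only: matrix_mul_rid)
  thus ?thesis
    by (simp only: matrix_mul_assoc BA matrix_mul_lid)
qed

lift_definition pgl_inv :: "'a::field pgl2 \<Rightarrow> 'a pgl2" is matrix_inv
proof -
  fix A B :: "'a^2^2" assume "pgl_rel A B"
  then obtain c where c: "invertible A" "c \<noteq> 0" "B = scale_matrix c A"
    by (auto simp: pgl_rel_def)
  then obtain A' where A': "A ** A' = mat 1" "A' ** A = mat 1"
    by (auto simp: invertible_def)
  let ?B' = "scale_matrix (inverse c) A'"
  have "scale_matrix c X ** scale_matrix (inverse c) Y = X ** Y"
       "scale_matrix (inverse c) Y ** scale_matrix c X = Y ** X" for X Y :: "'a^2^2"
  proof -
    have "c * x * (inverse c * y) = x * y" "inverse c * y * (c * x) = y * x" for x y :: 'a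
      using c(2) by (simp_all add: field_simps)
    thus "scale_matrix c X ** scale_matrix (inverse c) Y = X ** Y"
         "scale_matrix (inverse c) Y ** scale_matrix c X = Y ** X"
      unfolding scale_matrix_def matrix_matrix_mult_def vec_lambda_beta by (simp_all only:)
  qed
  hence B': "B ** ?B' = mat 1" "?B' ** B = mat 1"
    using A' c(3) by simp_all
  have "invertible A'" "invertible ?B'"
    using A' B' unfolding invertible_def by blast+
  moreover have "matrix_inv A = A'" "matrix_inv B = ?B'"
    using A' B' by (auto intro: matrix_inv_eqI)
  ultimately show "pgl_rel (matrix_inv A) (matrix_inv B)"
    unfolding pgl_rel_def using c(2) by (intro conjI exI[of _ "inverse c"]) auto
qed

definition matrix_apply :: "'a::field^2^2 \<Rightarrow> 'a proj_line \<Rightarrow> 'a proj_line"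
  where "matrix_apply A p = (case p of
      Aff z \<Rightarrow>
        if A$2$1 * z + A$2$2 = 0 then Infty
        else Aff ((A$1$1 * z + A$1$2) / (A$2$1 * z + A$2$2))
    | Infty \<Rightarrow> if A$2$1 = 0 then Infty else Aff (A$1$1 / A$2$1))"

lift_definition pgl_apply :: "'a::field pgl2 \<Rightarrow> 'a proj_line \<Rightarrow> 'a proj_line" is matrix_apply
proof -
  fix A B :: "'a^2^2"
  assume "pgl_rel A B"
  then obtain c where c: "c \<noteq> 0" "B = scale_matrix c A"
    by (auto simp: pgl_rel_def)
  have B: "B$i$j = c * A$i$j" for i j
    by (simp add: c scale_matrix_def)
  have B': "B$i$1 * z + B$i$2 = c * (A$i$1 * z + A$i$2)" for i z
    by (simp add: B algebra_simps)
  show "matrix_apply A = matrix_apply B"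
    unfolding matrix_apply_def B' using c(1) by (simp add: B fun_eq_iff split: proj_line.split)
qed

lift_definition pgl_rat :: "'a::field pgl2 \<Rightarrow> 'a poly fract"
  is "\<lambda>A. to_fract [:A$1$2, A$1$1:] / to_fract [:A$2$2, A$2$1:]"
proof -
  fix A B :: "'a^2^2"
  assume "pgl_rel A B"
  then obtain c where c: "c \<noteq> 0" "B = scale_matrix c A"
    by (auto simp: pgl_rel_def)
  have "[:B$i$2, B$i$1:] = [:c:] * [:A$i$2, A$i$1:]" for i
    by (simp add: c scale_matrix_def)
  moreover have "to_fract [:c:] \<noteq> 0"
    using c(1) by simp
  ultimately show "to_fract [:A$1$2, A$1$1:] / to_fract [:A$2$2, A$2$1:] =
      to_fract [:B$1$2, B$1$1:] / to_fract [:B$2$2, B$2$1:]"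
    by (simp only: to_fract_mult mult_divide_mult_cancel_left not_False_eq_True)
qed

definition pgl_conj :: "'a::field pgl2 \<Rightarrow> 'a poly fract \<Rightarrow> 'a poly fract"
  where "pgl_conj h \<phi> = rat_comp (rat_comp (pgl_rat h) \<phi>) (pgl_rat (pgl_inv h))"


section \<open>Fixed points\<close>

text \<open>The conjugate \<open>1 / \<phi>(1 / z)\<close>, which exchanges the roles of \<open>0\<close> and \<open>\<infinity>\<close>.\<close>

definition rat_flip :: "'a::field poly fract \<Rightarrow> 'a poly fract"
  where "rat_flip \<phi> = 1 / rat_comp \<phi> (1 / rat_X)"

definition is_fixed_point :: "'a::field poly fract \<Rightarrow> 'a proj_line \<Rightarrow> bool"
  where "is_fixed_point \<phi> p \<longleftrightarrow> rat_apply \<phi> p = p"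

definition fixed_multiplicity :: "'a::field poly fract \<Rightarrow> 'a proj_line \<Rightarrow> nat"
  where "fixed_multiplicity \<phi> p = (case p of
      Aff a \<Rightarrow> nat (rat_order a (\<phi> - rat_X))
    | Infty \<Rightarrow> nat (rat_order 0 (rat_flip \<phi> - rat_X)))"

definition multiplier :: "'a::field poly fract \<Rightarrow> 'a proj_line \<Rightarrow> 'a"
  where "multiplier \<phi> p = (case p of
      Aff a \<Rightarrow> rat_value (rat_deriv \<phi>) a
    | Infty \<Rightarrow> rat_value (rat_deriv (rat_flip \<phi>)) 0)"

definition repelling :: "'a::nonarch_field poly fract \<Rightarrow> 'a proj_line \<Rightarrow> bool"
  where "repelling \<phi> p \<longleftrightarrow> is_fixed_point \<phi> p \<and> absv (multiplier \<phi> p) > 1"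

definition indifferent :: "'a::nonarch_field poly fract \<Rightarrow> 'a proj_line \<Rightarrow> bool"
  where "indifferent \<phi> p \<longleftrightarrow> is_fixed_point \<phi> p \<and> absv (multiplier \<phi> p) = 1"

definition attracting :: "'a::nonarch_field poly fract \<Rightarrow> 'a proj_line \<Rightarrow> bool"
  where "attracting \<phi> p \<longleftrightarrow> is_fixed_point \<phi> p \<and> absv (multiplier \<phi> p) < 1"

text \<open>
  The points \<open>x 1, \<dots>, x (d + 1)\<close>, where \<open>d = deg \<phi>\<close>, are the fixed points of \<open>\<phi>\<close>, repeated
  according to multiplicity.
\<close>

definition enumerates_fixed_points :: "'a::field poly fract \<Rightarrow> (nat \<Rightarrow> 'a proj_line) \<Rightarrow> bool"
  where "enumerates_fixed_points \<phi> x \<longleftrightarrow>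
    (\<forall>p. card {i \<in> {1..rat_degree \<phi> + 1}. x i = p} =
       (if is_fixed_point \<phi> p then fixed_multiplicity \<phi> p else 0))"


section \<open>Good reduction\<close>

text \<open>
  The degree of the quotient of two polynomials after cancellation of common factors, where the
  constant \<open>\<infinity>\<close> (zero denominator) has degree \<open>0\<close>.
\<close>

definition quot_degree :: "'a::field poly \<Rightarrow> 'a poly \<Rightarrow> nat"
  where "quot_degree f g = (if g = 0 then 0 else rat_degree (to_fract f / to_fract g))"

definition good_reduction :: "'a::nonarch_field poly fract \<Rightarrow> bool"
  where "good_reduction \<phi> \<longleftrightarrow>
    (\<exists>f g. is_quot \<phi> f g \<and> integral_poly f \<and> integral_poly g \<and>
       (\<exists>i. absv (coeff f i) = 1 \<or> absv (coeff g i) = 1) \<and>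
       quot_degree (reduce_poly f) (reduce_poly g) = rat_degree \<phi>)"

definition potentially_good_reduction :: "'a::nonarch_field poly fract \<Rightarrow> bool"
  where "potentially_good_reduction \<phi> \<longleftrightarrow> (\<exists>h. good_reduction (pgl_conj h \<phi>))"


section \<open>Algebraic closures\<close>

text \<open>
  The algebraically closed field \<open>'a\<close>, together with the embedding \<open>\<iota>\<close>, is an algebraic closure
  of \<open>'k\<close>.
\<close>

definition is_algebraic_closure :: "('k::field \<Rightarrow> 'a::alg_closed_field) \<Rightarrow> bool"
  where "is_algebraic_closure \<iota> \<longleftrightarrow>
    \<iota> 1 = 1 \<and> (\<forall>x y. \<iota> (x + y) = \<iota> x + \<iota> y) \<and> (\<forall>x y. \<iota> (x * y) = \<iota> x * \<iota> y) \<and>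
    (\<forall>z. \<exists>p. p \<noteq> 0 \<and> poly (map_poly \<iota> p) z = 0)"

end

theory Submission
  imports Defs
begin

text \<open>
  Let \<open>T\<close> be a homogeneous lift of \<open>\<Phi>\<close> to the plane. In the coordinate given by a matrix \<open>A\<close>, the map
  \<open>\<Phi>\<close> has good reduction iff \<open>\<parallel>T v\<parallel> = C \<parallel>v\<parallel>\<^sup>d\<close> for all \<open>v\<close> and some constant \<open>C\<close>, where \<open>\<parallel>v\<parallel>\<close> is
  the maximum norm of \<open>A v\<close>. This turns potentially good reduction into the existence of a norm on the
  plane, so that \<open>\<Phi>\<close> itself need not be conjugated.

  Let \<open>v\<close> span a fixed line with multiplier \<open>\<kappa>\<close>, and expand \<open>det (v, T (v + t w))\<close> in powers of \<open>t\<close> for a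
  vector \<open>w\<close> orthogonal to \<open>v\<close> and of the same norm. All coefficients are bounded by some \<open>K\<close>, and the
  linear one has size \<open>\<bar>\<kappa>\<bar> K\<close>. Hence \<open>\<bar>\<kappa>\<bar> \<le> 1\<close>; if \<open>\<bar>\<kappa>\<bar> = 1\<close>, then \<open>v\<close> is the only preimage of itself in its
  residue class; if \<open>\<bar>\<kappa>\<bar> < 1\<close>, then \<open>v\<close> is the only fixed point in its residue class. In both cases of
  the theorem the three chosen points therefore have distinct reductions, and the coordinate that sends
  them to \<open>0, 1, \<infinity>\<close> has the same norm as \<open>A\<close> up to scaling.
\<close>

section \<open>Homogeneous lifts\<close>

text \<open>The homogenization of \<open>f\<close> to degree \<open>d\<close>. The coefficient sum
  also makes sense at y = 0, that is, at infinity; coefficients of index above \<open>d\<close> are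
  dropped, hence the degree bounds in later facts.\<close>

definition form :: "nat \<Rightarrow> 'a::comm_ring_1 poly \<Rightarrow> 'a \<Rightarrow> 'a \<Rightarrow> 'a"
  where "form d f x y = (\<Sum>i\<le>d. coeff f i * x ^ i * y ^ (d - i))"

text \<open>The homogeneous version of substituting the fraction p/q. Depending on \<open>p\<close>
  and \<open>q\<close> it serves for composition, for the swap of 0 and infinity, and for the
  restriction to a line in the plane.\<close>

definition form_subst :: "nat \<Rightarrow> 'a::comm_ring_1 poly \<Rightarrow> 'a poly \<Rightarrow> 'a poly \<Rightarrow> 'a poly"
  where "form_subst d f p q = (\<Sum>i\<le>d. smult (coeff f i) (p ^ i * q ^ (d - i)))"

definition hlift :: "nat \<Rightarrow> 'a::comm_ring_1 poly \<Rightarrow> 'a poly \<Rightarrow> 'a^2 \<Rightarrow> 'a^2"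
  where "hlift d f g v = vector [form d f (v$1) (v$2), form d g (v$1) (v$2)]"

lemma vec2_eq_iff: "(v :: 'a^2) = w \<longleftrightarrow> v$1 = w$1 \<and> v$2 = w$2"
  by (simp add: vec_eq_iff forall_2)

lemma vec2_eq_0_iff: "(v :: 'a::zero^2) = 0 \<longleftrightarrow> v$1 = 0 \<and> v$2 = 0"
  by (simp add: vec2_eq_iff)

lemma matrix_vector_mult_2:
  "((A :: 'a::comm_ring_1^2^2) *v v) $ i = A$i$1 * v$1 + A$i$2 * v$2"
  by (simp add: matrix_vector_mult_def sum_2)

lemma hlift_nth [simp]:
  "hlift d f g v $ 1 = form d f (v$1) (v$2)" "hlift d f g v $ 2 = form d g (v$1) (v$2)"
  by (simp_all add: hlift_def)

lemma poly_form_subst: "poly (form_subst d f p q) t = form d f (poly p t) (poly q t)"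
  by (simp add: form_subst_def form_def poly_sum poly_power mult.assoc)

lemma form_scale: "form d f (c * x) (c * y) = c ^ d * form d f x y"
proof -
  have "coeff f i * (c * x) ^ i * (c * y) ^ (d - i) = c ^ d * (coeff f i * x ^ i * y ^ (d - i))"
    if "i \<le> d" for i
  proof -
    have "c ^ d = c ^ i * c ^ (d - i)" using that by (simp flip: power_add)
    thus ?thesis by (simp add: power_mult_distrib algebra_simps)
  qed
  thus ?thesis by (simp add: form_def sum_distrib_left)
qed

lemma form_add: "form d (f + g) x y = form d f x y + form d g x y"
  by (simp add: form_def sum.distrib algebra_simps)

lemma form_smult: "form d (smult c f) x y = c * form d f x y"
  by (simp add: form_def sum_distrib_left algebra_simps)

lemma form_1_right:
  assumes "degree f \<le> d"
  shows "form d f x 1 = poly f x"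
proof -
  have "form d f x 1 = (\<Sum>i\<le>d. coeff f i * x ^ i)" by (simp add: form_def)
  also have "\<dots> = (\<Sum>i\<le>degree f. coeff f i * x ^ i)"
    using assms by (intro sum.mono_neutral_right) (auto simp: coeff_eq_0)
  finally show ?thesis by (simp add: poly_altdef)
qed

lemma form_1_0: "form d f 1 0 = coeff f d"
proof -
  have "form d f 1 0 = (\<Sum>i\<le>d. if i = d then coeff f i else 0)"
    unfolding form_def by (intro sum.cong) (auto simp: power_0_left)
  thus ?thesis by simp
qed

lemma form_nonzero:
  fixes f :: "'a::field poly"
  assumes "degree f \<le> d" "y \<noteq> 0"
  shows "form d f x y = y ^ d * poly f (x / y)"
  using form_scale[of d f y "x / y" 1] assms by (simp add: form_1_right)

lemma form_0_right: "form d f x 0 = x ^ d * coeff f d"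
  using form_scale[of d f x 1 0] by (simp add: form_1_0)

lemma degree_form_subst_le:
  assumes "degree p \<le> 1" "degree q \<le> 1"
  shows "degree (form_subst d f p q) \<le> d"
proof -
  have "degree (smult (coeff f i) (p ^ i * q ^ (d - i))) \<le> d" if "i \<le> d" for i
  proof -
    have "degree (p ^ i * q ^ (d - i)) \<le> degree (p ^ i) + degree (q ^ (d - i))"
      by (rule degree_mult_le)
    also have "\<dots> \<le> degree p * i + degree q * (d - i)"
      by (intro add_mono degree_power_le)
    also have "\<dots> \<le> 1 * i + 1 * (d - i)"
      using assms by (intro add_mono mult_mono) auto
    finally show ?thesis using that degree_smult_le[of "coeff f i" "p ^ i * q ^ (d - i)"] by simp
  qed
  thus ?thesis unfolding form_subst_def by (intro degree_sum_le) auto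
qed

lemma hlift_scale: "hlift d f g (c *s v) = c ^ d *s hlift d f g v"
  by (simp add: vec2_eq_iff form_scale)

lemma form_subst_linear:
  "degree f \<le> 1 \<Longrightarrow> form_subst 1 f p q = smult (coeff f 0) q + smult (coeff f 1) p"
  by (simp add: form_subst_def)

section \<open>Fractional representations\<close>

text \<open>
  The library's gcd on polynomials needs the coefficient field to be of class \<^class>\<open>field_gcd\<close>,
  hence this direct proof.
\<close>

lemma poly_bezout:
  fixes f g :: "'a::field poly"
  assumes "coprime f g"
  obtains a b where "a * f + b * g = 1"
proof -
  have "\<exists>a b. a * f + b * g = 1"
    using assms
  \<comment> \<open>Euclid's algorithm; the measure has to tell \<open>g = 0\<close> from a nonzero
    constant, both of degree 0.\<close>
  proof (induction "if g = 0 then 0 else Suc (degree g)" arbitrary: f g rule: less_induct)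
    case less
    show ?case
    proof (cases "g = 0")
      case True
      with less.prems have "f dvd 1" by simp
      then obtain a where "1 = f * a" by (auto elim: dvdE)
      with True show ?thesis by (metis add.right_neutral mult.commute mult_zero_left)
    next
      case False
      have cop: "coprime g (f mod g)"
        using less.prems by (metis coprime_def dvd_mod_iff)
      have "\<exists>a b. a * g + b * (f mod g) = 1"
        by (rule less.hyps[OF _ cop]) (use False degree_mod_less'[of g f] in auto)
      then obtain a b where "a * g + b * (f mod g) = 1" by blast
      hence "b * f + (a - b * (f div g)) * g = 1"
        by (simp add: algebra_simps minus_div_mult_eq_mod[symmetric])
      thus ?thesis by blast
    qed
  qed
  with that show thesis by blast
qed

lemma coprime_dvd_mult_poly:
  fixes f g h :: "'a::field poly"
  assumes "coprime f g" "g dvd f * h"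
  shows "g dvd h"
proof -
  obtain a b where "a * f + b * g = 1" using poly_bezout[OF assms(1)] .
  hence "h = a * (f * h) + b * h * g"
    by (metis (no_types, opaque_lifting) distrib_right mult.assoc mult.commute mult_1)
  thus ?thesis using assms(2) by (metis dvd_add dvd_mult dvd_triv_right)
qed

text \<open>By Euclid's lemma the two denominators divide each other. As \<open>rat_num\<close> and
  \<open>rat_den\<close> come from a choice operator, this is what transfers facts about them to any
  coprime pair.\<close>

lemma is_quot_unique:
  assumes "is_quot \<phi> f g" "is_quot \<phi> f' g'"
  obtains c where "c \<noteq> 0" "f' = smult c f" "g' = smult c g"
proof -
  have nz: "g \<noteq> 0" "g' \<noteq> 0" and cop: "coprime f g" "coprime f' g'"
    and eq: "to_fract f / to_fract g = to_fract f' / to_fract g'"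
    using assms by (auto simp: is_quot_def)
  have "to_fract (f * g') = to_fract (f' * g)"
    using eq nz by (simp add: field_simps)
  hence *: "f * g' = f' * g" by (simp only: to_fract_eq_iff)
  have "g dvd f * g'" unfolding * by simp
  hence "g dvd g'"
    using cop coprime_dvd_mult_poly by blast
  then obtain k where k: "g' = g * k" by (auto elim: dvdE)
  have "g' dvd f' * g" unfolding *[symmetric] by simp
  hence "g' dvd g"
    using cop coprime_dvd_mult_poly by blast
  then obtain m where "g = g' * m" by (auto elim: dvdE)
  hence "g * (k * m) = g * 1" using k by (simp add: mult.assoc)
  hence "k * m = 1" using nz by (metis mult_left_cancel)
  hence "is_unit k" by (metis dvd_triv_left)
  then obtain c where c: "k = [:c:]" "c dvd 1"
    unfolding is_unit_poly_iff by blast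
  hence "c \<noteq> 0" by auto
  have g': "g' = smult c g" using k c by simp
  hence "smult c f * g = f' * g" using * by (simp add: mult.commute)
  hence "f' = smult c f" using nz by (metis mult_right_cancel)
  with g' \<open>c \<noteq> 0\<close> that show thesis by blast
qed

lemma rat_degree_eq:
  assumes "is_quot \<phi> f g"
  shows "rat_degree \<phi> = max (degree f) (degree g)"
proof -
  obtain c where "c \<noteq> 0" "rat_num \<phi> = smult c f" "rat_den \<phi> = smult c g"
    using is_quot_unique[OF assms is_quot_rat_num_den] .
  thus ?thesis by (simp add: rat_degree_def)
qed

text \<open>For \<open>d > 0\<close> over an algebraically closed field this says that the resultant
  of the two degree-\<open>d\<close> forms is nonzero. It merges coprimality with the degree
  condition and passes easily through linear changes of coordinates.\<close>

definition nondeg :: "nat \<Rightarrow> 'a::field poly \<Rightarrow> 'a poly \<Rightarrow> bool"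
  where "nondeg d f g \<longleftrightarrow> degree f \<le> d \<and> degree g \<le> d \<and> (\<forall>v. hlift d f g v = 0 \<longrightarrow> v = 0)"

lemma nondegD:
  "nondeg d f g \<Longrightarrow> degree f \<le> d" "nondeg d f g \<Longrightarrow> degree g \<le> d"
  "nondeg d f g \<Longrightarrow> hlift d f g v = 0 \<Longrightarrow> v = 0"
  by (auto simp: nondeg_def)

text \<open>A common zero of the forms is either a common root of \<open>f\<close> and
  \<open>g\<close> or the point at infinity, where both coefficients of index \<open>d\<close> would
  vanish.\<close>

lemma nondegI:
  assumes "coprime f g" "max (degree f) (degree g) = d" "d > 0"
  shows "nondeg d f g"
proof -
  have deg: "degree f \<le> d" "degree g \<le> d" using assms by auto
  have "v = 0" if v: "hlift d f g v = 0" for v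
  proof (cases "v$2 = 0")
    case True
    have "coeff f d \<noteq> 0 \<or> coeff g d \<noteq> 0"
      using assms(2,3) by (auto simp: max_def split: if_splits)
    with v True show ?thesis
      using assms by (auto simp: vec2_eq_0_iff form_0_right)
  next
    case False
    hence "poly f (v$1 / v$2) = 0" "poly g (v$1 / v$2) = 0"
      using v deg by (auto simp: vec2_eq_0_iff form_nonzero)
    hence "[:- (v$1 / v$2), 1:] dvd f" "[:- (v$1 / v$2), 1:] dvd g"
      by (simp_all add: poly_eq_0_iff_dvd)
    hence "is_unit [:- (v$1 / v$2), 1:]" using \<open>coprime f g\<close> coprime_common_divisor by blast
    thus ?thesis by (simp add: is_unit_poly_iff)
  qed
  with deg show ?thesis by (auto simp: nondeg_def)
qed

text \<open>Converse of \<open>nondegI\<close>: over an algebraically closed field a nonconstant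
  common factor has a root, which is a common zero of the forms, and nonvanishing at infinity forces
  the degree \<open>d\<close>.\<close>

lemma nondeg_imp:
  fixes f g :: "'a::alg_closed_field poly"
  assumes "nondeg d f g" "d > 0"
  shows "coprime f g" "max (degree f) (degree g) = d" "g \<noteq> 0"
proof -
  note deg = nondegD(1,2)[OF assms(1)]
  have eval: "\<not> (poly f x = 0 \<and> poly g x = 0)" for x
    using nondegD(3)[OF assms(1), of "vector [x, 1]"] deg
    by (auto simp: vec2_eq_0_iff form_1_right)
  have "\<not> (coeff f d = 0 \<and> coeff g d = 0)"
    using nondegD(3)[OF assms(1), of "vector [1, 0]"]
    by (auto simp: vec2_eq_0_iff form_1_0)
  hence "d \<le> degree f \<or> d \<le> degree g" using le_degree by blast
  thus 1: "max (degree f) (degree g) = d" using deg by auto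
  show cop: "coprime f g"
  proof (rule coprimeI)
    fix c assume c: "c dvd f" "c dvd g"
    show "is_unit c"
    proof (rule ccontr)
      assume "\<not> is_unit c"
      hence "c = 0 \<or> degree c > 0" by (cases "c = 0") (simp_all add: is_unit_iff_degree)
      then obtain x where "poly c x = 0" using alg_closed_imp_poly_has_root[of c] by auto
      with c eval[of x] show False by (auto elim!: dvdE)
    qed
  qed
  show "g \<noteq> 0"
  proof
    assume "g = 0"
    with cop have "is_unit f" by simp
    hence "degree f = 0" using is_unit_iff_degree[of f] by fastforce
    with 1 \<open>g = 0\<close> \<open>d > 0\<close> show False by simp
  qed
qed

section \<open>Composition of rational functions\<close>

lemma poly_at_rat_fract:
  fixes f :: "'a::field poly"
  assumes "degree f \<le> d" "q \<noteq> 0"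
  shows "poly_at_rat f (to_fract p / to_fract q) = to_fract (form_subst d f p q) / to_fract q ^ d"
proof -
  have pow: "to_fract (r ^ n) = to_fract r ^ n" for r :: "'a poly" and n
    by (induction n) simp_all
  have sm: "to_fract (smult c r) = to_fract [:c:] * to_fract r" for c and r :: "'a poly"
    by (simp flip: to_fract_mult)
  have "poly_at_rat f (to_fract p / to_fract q)
      = (\<Sum>i\<le>degree f. to_fract [:coeff f i:] * (to_fract p / to_fract q) ^ i)"
    unfolding poly_at_rat_def
    by (subst poly_altdef, subst degree_map_poly) (auto simp: coeff_map_poly)
  also have "\<dots> = (\<Sum>i\<le>d. to_fract [:coeff f i:] * (to_fract p / to_fract q) ^ i)"
    using assms by (intro sum.mono_neutral_left) (auto simp: coeff_eq_0)
  also have "\<dots> = (\<Sum>i\<le>d. to_fract (smult (coeff f i) (p ^ i * q ^ (d - i))) / to_fract q ^ d)"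
  proof (intro sum.cong refl)
    fix i assume "i \<in> {..d}"
    hence "to_fract q ^ d = to_fract q ^ i * to_fract q ^ (d - i)" by (simp flip: power_add)
    thus "to_fract [:coeff f i:] * (to_fract p / to_fract q) ^ i =
        to_fract (smult (coeff f i) (p ^ i * q ^ (d - i))) / to_fract q ^ d"
      using assms by (simp add: sm pow power_divide field_simps)
  qed
  finally show ?thesis by (simp add: form_subst_def sum_divide_distrib)
qed

text \<open>Numerator and denominator are cleared with the same power \<open>q ^ d\<close>, which
  cancels; hence one bound \<open>d\<close> for both degrees.\<close>

lemma rat_comp_fract:
  fixes f g :: "'a::field poly"
  assumes "is_quot \<phi> f g" "degree f \<le> d" "degree g \<le> d" "q \<noteq> 0"
  shows "rat_comp \<phi> (to_fract p / to_fract q) =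
    to_fract (form_subst d f p q) / to_fract (form_subst d g p q)"
proof -
  obtain c where c: "c \<noteq> 0" "rat_num \<phi> = smult c f" "rat_den \<phi> = smult c g"
    using is_quot_unique[OF assms(1) is_quot_rat_num_den] .
  have sub: "form_subst d (smult c h) p q = [:c:] * form_subst d h p q" for h
    unfolding form_subst_def sum_distrib_left by (intro sum.cong refl) (simp add: mult.commute)
  have "rat_comp \<phi> (to_fract p / to_fract q) =
      to_fract ([:c:] * form_subst d f p q) / to_fract ([:c:] * form_subst d g p q)"
    using assms c by (simp add: rat_comp_def poly_at_rat_fract[of _ d] sub)
  also have "\<dots> = to_fract (form_subst d f p q) / to_fract (form_subst d g p q)"
    unfolding to_fract_mult using c(1) by (intro mult_divide_mult_cancel_left) simp
  finally show ?thesis .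
qed

section \<open>The residue field\<close>

lemma absv_power: "absv (x ^ n :: 'a::nonarch_field) = absv x ^ n"
  by (induction n) (simp_all add: absv_mult)

lemma absv_divide: "absv (x / y :: 'a::nonarch_field) = absv x / absv y"
  by (simp add: divide_inverse absv_mult absv_inverse)

lemma absv_sum_le:
  assumes "\<And>i. i \<in> A \<Longrightarrow> absv (f i :: 'a::nonarch_field) \<le> C" "C \<ge> 0"
  shows "absv (sum f A) \<le> C"
  using assms
proof (induction A rule: infinite_finite_induct)
  case (insert x A)
  have "absv (f x) \<le> C" "absv (sum f A) \<le> C" using insert by auto
  thus ?case using absv_add_le_max[of "f x" "sum f A"] insert.hyps by simp
qed simp_all

lemma absv_sum_less:
  assumes "\<And>i. i \<in> A \<Longrightarrow> absv (f i :: 'a::nonarch_field) < C" "C > 0"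
  shows "absv (sum f A) < C"
  using assms
proof (induction A rule: infinite_finite_induct)
  case (insert x A)
  have "absv (f x) < C" "absv (sum f A) < C" using insert by auto
  thus ?case using absv_add_le_max[of "f x" "sum f A"] insert.hyps by simp
qed simp_all

lemma absv_add_eq:
  assumes "absv y < absv (x :: 'a::nonarch_field)"
  shows "absv (x + y) = absv x"
proof -
  have "absv x \<le> max (absv (x + y)) (absv y)"
    using absv_diff_le_max[of "x + y" y] by simp
  with assms absv_add_le_max[of x y] show ?thesis by auto
qed

lemma absv_pos: "x \<noteq> 0 \<Longrightarrow> absv (x :: 'a::nonarch_field) > 0"
  using absv_nonneg[of x] absv_eq_0_iff[of x] by linarith

lemma abs_residue_eq_0_iff:
  assumes "absv (x :: 'a::nonarch_field) \<le> 1"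
  shows "abs_residue x = 0 \<longleftrightarrow> absv x < 1"
proof -
  have "residue_rel x x" "residue_rel (0::'a) 0" using assms by (simp_all add: residue_rel_def)
  hence "abs_residue x = abs_residue 0 \<longleftrightarrow> residue_rel x 0"
    using Quotient3_rel[OF Quotient3_residue, of x 0] by blast
  thus ?thesis using assms by (simp add: zero_residue_def residue_rel_def)
qed

lemma abs_residue_0 [simp]: "abs_residue 0 = 0"
  by (simp add: zero_residue_def)

lemma abs_residue_1 [simp]: "abs_residue 1 = 1"
  by (simp add: one_residue_def)

lemma abs_residue_add:
  "absv (x :: 'a::nonarch_field) \<le> 1 \<Longrightarrow> absv y \<le> 1 \<Longrightarrow>
    abs_residue (x + y) = abs_residue x + abs_residue y"
  by (simp add: plus_residue.abs_eq residue_rel_def)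

lemma abs_residue_mult:
  "absv (x :: 'a::nonarch_field) \<le> 1 \<Longrightarrow> absv y \<le> 1 \<Longrightarrow>
    abs_residue (x * y) = abs_residue x * abs_residue y"
  by (simp add: times_residue.abs_eq residue_rel_def)

lemma abs_residue_surj:
  obtains x :: "'a::nonarch_field" where "absv x \<le> 1" "abs_residue x = r"
proof -
  have "residue_rel (rep_residue r) (rep_residue r)"
    by (rule Quotient3_rep_reflp[OF Quotient3_residue])
  moreover have "abs_residue (rep_residue r) = r"
    by (rule Quotient3_abs_rep[OF Quotient3_residue])
  ultimately show thesis using that by (auto simp: residue_rel_def)
qed

lemma coeff_reduce_poly: "coeff (reduce_poly f) i = abs_residue (coeff f i)"
  by (simp add: reduce_poly_def coeff_map_poly)

lemma degree_reduce_poly_le: "degree (reduce_poly f) \<le> degree f"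
  by (intro degree_le) (simp add: coeff_reduce_poly coeff_eq_0)

lemma integral_poly_pCons_iff: "integral_poly (pCons c f) \<longleftrightarrow> absv c \<le> 1 \<and> integral_poly f"
proof -
  have "(\<forall>i. P i) \<longleftrightarrow> P 0 \<and> (\<forall>i. P (Suc i))" for P :: "nat \<Rightarrow> bool"
    by (metis nat.exhaust)
  from this[of "\<lambda>i. absv (coeff (pCons c f) i) \<le> 1"] show ?thesis
    by (simp add: integral_poly_def)
qed

lemma reduce_poly_pCons: "reduce_poly (pCons c f) = pCons (abs_residue c) (reduce_poly f)"
  by (rule poly_eqI) (simp add: coeff_reduce_poly coeff_pCons split: nat.split)

lemma absv_poly_le_1:
  assumes "integral_poly f" "absv t \<le> 1"
  shows "absv (poly f t) \<le> 1"
  using assms(1)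
proof (induction f)
  case (pCons c f)
  thus ?case using assms(2)
    by (auto simp: integral_poly_pCons_iff intro!: absv_add_le_1 absv_mult_le_1)
qed simp

lemma poly_reduce_poly:
  assumes "integral_poly f" "absv t \<le> 1"
  shows "poly (reduce_poly f) (abs_residue t) = abs_residue (poly f t)"
  using assms(1)
proof (induction f)
  case 0
  thus ?case by (simp add: reduce_poly_def)
next
  case (pCons c f)
  thus ?case using assms(2)
    by (simp add: integral_poly_pCons_iff reduce_poly_pCons abs_residue_add abs_residue_mult
        absv_poly_le_1 absv_mult_le_1)
qed

section \<open>Lifting polynomials and roots from the residue field\<close>

lemma reduce_poly_surj:
  obtains f :: "'a::nonarch_field poly"
  where "integral_poly f" "reduce_poly f = k" "degree f = degree k"
proof -
  \<comment> \<open>The last clause carries the induction: over \<open>k = 0\<close> a nonzero lift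
    of the tail would make the degree of \<open>pCons c f\<close> too large.\<close>
  have "\<exists>f :: 'a poly. integral_poly f \<and> reduce_poly f = k \<and> degree f = degree k \<and> (k = 0 \<longrightarrow> f = 0)"
  proof (induction k)
    case 0
    show ?case by (intro exI[of _ 0]) (simp add: integral_poly_def reduce_poly_def)
  next
    case (pCons r k)
    then obtain f :: "'a poly" where f: "integral_poly f" "reduce_poly f = k" "degree f = degree k"
      "k = 0 \<longrightarrow> f = 0" by blast
    obtain c :: 'a where c: "absv c \<le> 1" "abs_residue c = r" using abs_residue_surj .
    have "k \<noteq> 0 \<Longrightarrow> f \<noteq> 0" using f by (auto simp: reduce_poly_def)
    with f c pCons(1) show ?case
      by (intro exI[of _ "pCons c f"])
         (auto simp: integral_poly_pCons_iff reduce_poly_pCons)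
  qed
  with that show thesis by blast
qed

text \<open>Elements integral over the ring of integers lie in it: for |t| > 1 the leading term
  would strictly dominate the sum of the others.\<close>

lemma absv_root_le_1:
  fixes f :: "'a::nonarch_field poly"
  assumes "integral_poly f" "absv (lead_coeff f) = 1" "degree f > 0" "poly f t = 0"
  shows "absv t \<le> 1"
proof (rule ccontr)
  assume "\<not> absv t \<le> 1"
  hence t: "absv t > 1" by simp
  let ?n = "degree f"
  have "absv (\<Sum>i<?n. coeff f i * t ^ i) < absv t ^ ?n"
  proof (rule absv_sum_less)
    fix i assume i: "i \<in> {..<?n}"
    have "absv (coeff f i * t ^ i) \<le> 1 * absv t ^ i"
      unfolding absv_mult absv_power using assms(1) t
      by (intro mult_right_mono) (auto simp: integral_poly_def)
    also have "\<dots> < absv t ^ ?n" using i t by simp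
    finally show "absv (coeff f i * t ^ i) < absv t ^ ?n" .
  qed (use t in auto)
  moreover have "poly f t = lead_coeff f * t ^ ?n + (\<Sum>i<?n. coeff f i * t ^ i)"
    by (simp add: poly_altdef lessThan_Suc_atMost[symmetric])
  ultimately have "absv (poly f t) = absv t ^ ?n"
    using assms(2) absv_add_eq[of "\<Sum>i<?n. coeff f i * t ^ i" "lead_coeff f * t ^ ?n"]
    by (simp add: absv_mult absv_power)
  with assms(4) t show False by simp
qed

text \<open>Lift to an integral polynomial of the same degree. Its leading coefficient is a unit, so
  every root is integral and can be reduced.\<close>

lemma residue_poly_has_root:
  fixes k :: "'a::{alg_closed_field, nonarch_field} residue poly"
  assumes "degree k > 0"
  obtains t :: 'a where "absv t \<le> 1" "poly k (abs_residue t) = 0"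
proof -
  obtain f :: "'a poly" where f: "integral_poly f" "reduce_poly f = k" "degree f = degree k"
    using reduce_poly_surj .
  have "abs_residue (lead_coeff f) \<noteq> 0"
    using f assms by (metis coeff_reduce_poly leading_coeff_0_iff degree_0 less_irrefl)
  moreover have le: "absv (lead_coeff f) \<le> 1" using f by (auto simp: integral_poly_def)
  ultimately have lc: "absv (lead_coeff f) = 1" by (simp add: abs_residue_eq_0_iff)
  obtain t where t: "poly f t = 0"
    using alg_closed_imp_poly_has_root[of f] f assms by auto
  have "absv t \<le> 1" using absv_root_le_1[OF f(1) lc _ t] f assms by simp
  moreover from this have "poly k (abs_residue t) = 0"
    using poly_reduce_poly[OF f(1)] f t by simp
  ultimately show thesis using that by blast
qed

text \<open>This allows \<open>nondeg_imp\<close> to be applied to reduced forms.\<close>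

instance residue :: ("{alg_closed_field, nonarch_field}") alg_closed_field
proof
  fix k :: "'a residue poly"
  assume "degree k > 0"
  thus "\<exists>r. poly k r = 0" by (metis residue_poly_has_root)
qed

text \<open>Over a finite residue field the product of all X - r, plus 1, would be a nonconstant
  polynomial without root.\<close>

lemma infinite_residue: "infinite (UNIV :: 'a::{alg_closed_field, nonarch_field} residue set)"
proof
  assume fin: "finite (UNIV :: 'a residue set)"
  define k :: "'a residue poly" where "k = (\<Prod>r\<in>UNIV. [:- r, 1:]) + 1"
  have deg: "degree (\<Prod>r\<in>UNIV. [:- r, 1 :: 'a residue:]) = card (UNIV :: 'a residue set)"
    by (subst degree_prod_eq_sum_degree) simp_all
  have "card (UNIV :: 'a residue set) > 0" using fin by (simp add: card_gt_0_iff)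
  hence "degree k > 0" unfolding k_def using deg by (subst degree_add_eq_left) simp_all
  then obtain t :: 'a where "poly k (abs_residue t) = 0" by (rule residue_poly_has_root)
  moreover have "poly k s = 1" for s
    unfolding k_def using fin by (simp add: poly_prod)
  ultimately show False by simp
qed

section \<open>Gauss norms of polynomials\<close>

lemma exists_max_coeff:
  fixes f g :: "'a::nonarch_field poly"
  assumes "f \<noteq> 0 \<or> g \<noteq> 0"
  obtains c where "c \<noteq> 0" "integral_poly (smult c f)" "integral_poly (smult c g)"
    "\<exists>i. absv (coeff (smult c f) i) = 1 \<or> absv (coeff (smult c g) i) = 1"
proof -
  define S where "S = coeff f ` {..degree f} \<union> coeff g ` {..degree g}"
  have inS: "coeff f i \<in> S \<or> coeff f i = 0" "coeff g i \<in> S \<or> coeff g i = 0" for i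
    by (auto simp: S_def) (metis atMost_iff coeff_eq_0 imageI not_le)+
  have "finite S" "S \<noteq> {}" by (auto simp: S_def)
  then obtain m where m: "m \<in> S" "\<And>x. x \<in> S \<Longrightarrow> absv x \<le> absv m"
    using Max_in[of "absv ` S"] Max_ge[of "absv ` S"] by fastforce
  have le: "absv (coeff f i) \<le> absv m" "absv (coeff g i) \<le> absv m" for i
    using inS[of i] m absv_nonneg[of m] by auto
  have "m \<noteq> 0"
  proof
    assume "m = 0"
    hence "coeff f i = 0" "coeff g i = 0" for i
      using le[of i] absv_nonneg[of "coeff f i"] absv_nonneg[of "coeff g i"] absv_eq_0_iff
      by (auto simp: \<open>m = 0\<close>)
    hence "f = 0" "g = 0" by (auto intro: poly_eqI)
    with assms show False by blast
  qed
  moreover have "integral_poly (smult (inverse m) f)" "integral_poly (smult (inverse m) g)"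
    using le absv_pos[OF \<open>m \<noteq> 0\<close>] by (simp_all add: integral_poly_def absv_mult absv_inverse absv_divide field_simps)
  moreover have "\<exists>i. absv (coeff (smult (inverse m) f) i) = 1 \<or> absv (coeff (smult (inverse m) g) i) = 1"
  proof -
    obtain j where "m = coeff f j \<or> m = coeff g j" using m(1) by (auto simp: S_def)
    with \<open>m \<noteq> 0\<close> show ?thesis by (intro exI[of _ j]) auto
  qed
  ultimately show thesis using that[of "inverse m"] by simp
qed

text \<open>The residue field is infinite, so the Gauss norm is the maximum on the unit disk.\<close>

lemma absv_coeff_le:
  fixes f :: "'a::{alg_closed_field, nonarch_field} poly"
  assumes "\<And>t. absv t \<le> 1 \<Longrightarrow> absv (poly f t) \<le> C"
  shows "absv (coeff f i) \<le> C"
proof (cases "f = 0")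
  case True
  thus ?thesis using assms[of 0] by simp
next
  case False
  then obtain c where c: "c \<noteq> 0" "integral_poly (smult c f)" "\<exists>i. absv (coeff (smult c f) i) = 1"
    using exists_max_coeff[of f f] by metis
  then obtain j where "absv (coeff (smult c f) j) = 1" by blast
  hence "coeff (reduce_poly (smult c f)) j \<noteq> 0"
    unfolding coeff_reduce_poly by (subst abs_residue_eq_0_iff) auto
  hence "reduce_poly (smult c f) \<noteq> 0" by auto
  hence "finite {r. poly (reduce_poly (smult c f)) r = 0}" by (rule poly_roots_finite)
  \<comment> \<open>Over a residue class where the reduction does not vanish, the scaled polynomial
    has absolute value exactly 1, so \<open>C\<close> bounds the Gauss norm.\<close>
  then obtain r where r: "poly (reduce_poly (smult c f)) r \<noteq> 0"
    using infinite_residue[where 'a='a] ex_new_if_finite by blast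
  obtain t :: 'a where t: "absv t \<le> 1" "abs_residue t = r" using abs_residue_surj .
  have "absv (poly (smult c f) t) = 1"
    using r poly_reduce_poly[OF c(2) t(1)] t absv_poly_le_1[OF c(2) t(1)]
    by (auto simp: abs_residue_eq_0_iff)
  hence "1 \<le> absv c * C"
    using assms[OF t(1)] by (simp add: absv_mult) (metis absv_nonneg mult_left_mono)
  moreover have "absv c * absv (coeff f i) \<le> 1"
    using c(2) by (auto simp: integral_poly_def absv_mult)
  ultimately have "absv c * absv (coeff f i) \<le> absv c * C" by linarith
  thus ?thesis using absv_pos[OF c(1)] by simp
qed

section \<open>Forms and reduction\<close>

lemma abs_residue_sum:
  assumes "\<And>i. i \<in> A \<Longrightarrow> absv (f i :: 'a::nonarch_field) \<le> 1"
  shows "abs_residue (sum f A) = (\<Sum>i\<in>A. abs_residue (f i))"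
  using assms
proof (induction A rule: infinite_finite_induct)
  case (insert x A)
  have "absv (sum f A) \<le> 1" using insert.prems by (intro absv_sum_le) auto
  with insert show ?case by (simp add: abs_residue_add)
qed simp_all

lemma absv_power_le_1: "absv (x :: 'a::nonarch_field) \<le> 1 \<Longrightarrow> absv (x ^ n) \<le> 1"
  by (simp add: absv_power absv_nonneg power_le_one)

lemma abs_residue_power:
  "absv (x :: 'a::nonarch_field) \<le> 1 \<Longrightarrow> abs_residue (x ^ n) = abs_residue x ^ n"
  by (induction n) (simp_all add: abs_residue_mult absv_power_le_1)

lemma form_reduce:
  assumes "integral_poly f" "absv x \<le> 1" "absv y \<le> 1"
  shows "form d (reduce_poly f) (abs_residue x) (abs_residue y) = abs_residue (form d f x y)"
    and "absv (form d f x y) \<le> 1"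
proof -
  have le: "absv (coeff f i * x ^ i * y ^ (d - i)) \<le> 1" for i
    using assms by (auto simp: integral_poly_def intro!: absv_mult_le_1 absv_power_le_1)
  show "absv (form d f x y) \<le> 1"
    unfolding form_def by (rule absv_sum_le) (use le in auto)
  show "form d (reduce_poly f) (abs_residue x) (abs_residue y) = abs_residue (form d f x y)"
    unfolding form_def using assms le
    by (subst abs_residue_sum)
       (auto simp: abs_residue_mult abs_residue_power absv_mult_le_1 absv_power_le_1
          coeff_reduce_poly integral_poly_def)
qed

section \<open>Good reduction as an identity of norms\<close>

definition vnorm :: "'a::nonarch_field^2 \<Rightarrow> real"
  where "vnorm v = max (absv (v$1)) (absv (v$2))"

definition det2 :: "'a::comm_ring_1^2 \<Rightarrow> 'a^2 \<Rightarrow> 'a"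
  where "det2 v w = v$1 * w$2 - v$2 * w$1"

lemma vnorm_nonneg: "vnorm v \<ge> 0"
  by (simp add: vnorm_def absv_nonneg le_max_iff_disj)

lemma vnorm_eq_0_iff: "vnorm v = 0 \<longleftrightarrow> v = 0"
  using absv_nonneg[of "v$1"] absv_nonneg[of "v$2"]
  by (auto simp: vnorm_def vec2_eq_0_iff max_def absv_eq_0_iff)

lemma vnorm_0 [simp]: "vnorm 0 = 0"
  by (simp add: vnorm_eq_0_iff)

lemma vnorm_pos: "v \<noteq> 0 \<Longrightarrow> vnorm v > 0"
  using vnorm_nonneg[of v] vnorm_eq_0_iff[of v] by linarith

lemma vnorm_scale: "vnorm (c *s v) = absv c * vnorm v"
  by (simp add: vnorm_def absv_mult absv_nonneg max_mult_distrib_left)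

lemma vnorm_add: "vnorm (v + w) \<le> max (vnorm v) (vnorm w)"
  using absv_add_le_max[of "v$1" "w$1"] absv_add_le_max[of "v$2" "w$2"] by (auto simp: vnorm_def)

lemma normalize_vec:
  assumes "(v :: 'a::nonarch_field^2) \<noteq> 0"
  obtains c u where "c \<noteq> 0" "vnorm u = 1" "v = c *s u"
proof -
  define c where "c = (if absv (v$1) \<ge> absv (v$2) then v$1 else v$2)"
  have c: "absv c = vnorm v" by (auto simp: c_def vnorm_def)
  hence "absv c > 0" using vnorm_pos[OF assms] by simp
  hence "c \<noteq> 0" by auto
  moreover have "vnorm (inverse c *s v) = 1"
    using c \<open>absv c > 0\<close> by (simp add: vnorm_scale absv_inverse)
  moreover have "v = c *s (inverse c *s v)" using \<open>c \<noteq> 0\<close> by (simp add: vec2_eq_iff)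
  ultimately show thesis using that by blast
qed

lemma absv_det2_le: "absv (det2 v w) \<le> vnorm v * vnorm w"
proof -
  have "absv (v$1 * w$2) \<le> vnorm v * vnorm w" "absv (v$2 * w$1) \<le> vnorm v * vnorm w"
    unfolding absv_mult vnorm_def by (intro mult_mono; simp add: absv_nonneg le_max_iff_disj)+
  thus ?thesis unfolding det2_def using absv_diff_le_max[of "v$1 * w$2" "v$2 * w$1"] by linarith
qed

text \<open>The determinant of \<open>v\<close> with a standard basis vector is a coordinate of
  \<open>v\<close> up to sign; choose the larger one.\<close>

lemma orthogonal_vec_exists:
  obtains w where "w \<noteq> 0" "vnorm w = 1" "absv (det2 v w) = vnorm v"
proof (cases "absv (v$1) \<ge> absv (v$2)")
  case True
  show thesis by (rule that[of "vector [0, 1]"]) (use True in \<open>auto simp: vnorm_def det2_def vec2_eq_0_iff\<close>)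
next
  case False
  show thesis by (rule that[of "vector [1, 0]"]) (use False in \<open>auto simp: vnorm_def det2_def vec2_eq_0_iff\<close>)
qed

lemma hlift_0: "d > 0 \<Longrightarrow> hlift d f g 0 = 0"
  using hlift_scale[of d f g 0 0] by (simp add: vec2_eq_iff power_0_left)

lemma hlift_smult: "hlift d (smult c f) (smult c g) v = c *s hlift d f g v"
  by (simp add: vec2_eq_iff form_smult)

lemma vnorm_hlift_iff:
  assumes "d > 0"
  shows "(\<forall>v. vnorm (hlift d f g v) = C * vnorm v ^ d) \<longleftrightarrow> (\<forall>v. vnorm v = 1 \<longrightarrow> vnorm (hlift d f g v) = C)"
proof safe
  fix v assume *: "\<forall>v. vnorm v = 1 \<longrightarrow> vnorm (hlift d f g v) = C"
  show "vnorm (hlift d f g v) = C * vnorm v ^ d"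
  proof (cases "v = 0")
    case True
    thus ?thesis using assms by (simp add: hlift_0)
  next
    case False
    then obtain c u where "c \<noteq> 0" "vnorm u = 1" "v = c *s u" by (rule normalize_vec)
    thus ?thesis using * by (simp add: hlift_scale vnorm_scale absv_power)
  qed
qed simp

section \<open>Good reduction in terms of the lift\<close>

lemma quot_degree_imp_nondeg:
  assumes "quot_degree f g = d" "d > 0" "degree f \<le> d" "degree g \<le> d"
  shows "nondeg d f g"
proof -
  have "g \<noteq> 0" and rd: "rat_degree (to_fract f / to_fract g) = d"
    using assms by (auto simp: quot_degree_def split: if_splits)
  obtain p q where pq: "is_quot (to_fract f / to_fract g) p q" using is_quot_exists by blast
  hence max: "max (degree p) (degree q) = d" using rat_degree_eq rd by metis
  have "to_fract (f * q) = to_fract (p * g)"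
    using pq \<open>g \<noteq> 0\<close> by (auto simp: is_quot_def field_simps)
  hence eq: "f * q = p * g" by (simp only: to_fract_eq_iff)
  have "q dvd p * g" unfolding eq[symmetric] by simp
  hence "q dvd g" using pq coprime_dvd_mult_poly by (auto simp: is_quot_def)
  then obtain k where k: "g = q * k" by (auto elim: dvdE)
  have nz: "q \<noteq> 0" "k \<noteq> 0" using k \<open>g \<noteq> 0\<close> by auto
  have "f * q = (p * k) * q" using eq k by (simp add: mult_ac)
  hence f: "f = p * k" using nz by (metis mult_right_cancel)
  \<comment> \<open>One of \<open>p\<close>, \<open>q\<close> already has the full degree
    \<open>d\<close>, so the cancelled factor \<open>k\<close> is constant.\<close>
  have "degree k = 0"
  proof (cases "degree p = d")
    case True
    hence "p \<noteq> 0" using assms by auto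
    thus ?thesis using f nz True assms by (simp add: degree_mult_eq)
  next
    case False
    hence "degree q = d" using max by (auto simp: max_def split: if_splits)
    thus ?thesis using k nz assms by (simp add: degree_mult_eq)
  qed
  then obtain c where c: "k = [:c:]" by (rule degree_eq_zeroE)
  have "c \<noteq> 0" using nz c by auto
  have "nondeg d p q" using pq max assms(2) by (intro nondegI) (auto simp: is_quot_def)
  moreover have "hlift d f g v = c *s hlift d p q v" for v
    using k f c by (simp flip: hlift_smult)
  ultimately show ?thesis
    using assms \<open>c \<noteq> 0\<close> by (auto simp: nondeg_def vec2_eq_0_iff)
qed

text \<open>Good reduction means that the reduced forms have no common zero. Then a vector of norm
  1, whose reduction is nonzero, has an image of norm 1 under the normalized lift; conversely a
  nonzero common zero of the reduced forms lifts to a vector contradicting the norm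
  identity.\<close>

lemma good_reduction_iff:
  fixes f g :: "'a::{alg_closed_field, nonarch_field} poly"
  assumes quot: "is_quot \<phi> f g" and d: "max (degree f) (degree g) = d" "d > 0"
  shows "good_reduction \<phi> \<longleftrightarrow> (\<exists>C>0. \<forall>v. vnorm (hlift d f g v) = C * vnorm v ^ d)"
proof
  assume "good_reduction \<phi>"
  then obtain f' g' where fg: "is_quot \<phi> f' g'" "integral_poly f'" "integral_poly g'"
      "quot_degree (reduce_poly f') (reduce_poly g') = rat_degree \<phi>"
    by (auto simp: good_reduction_def)
  obtain c where c: "c \<noteq> 0" "f' = smult c f" "g' = smult c g" using is_quot_unique[OF quot fg(1)] .
  have "degree f' \<le> d" "degree g' \<le> d" using d by (auto simp: c)
  hence nd: "nondeg d (reduce_poly f') (reduce_poly g')"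
    using fg(4) d degree_reduce_poly_le[of f'] degree_reduce_poly_le[of g']
    by (intro quot_degree_imp_nondeg) (auto simp: rat_degree_eq[OF quot])
  have "vnorm (hlift d f' g' v) = 1" if v: "vnorm v = 1" for v
  proof (rule ccontr)
    have v12: "absv (v$1) \<le> 1" "absv (v$2) \<le> 1" using v by (auto simp: vnorm_def)
    note red = form_reduce[OF fg(2) v12] form_reduce[OF fg(3) v12]
    assume "vnorm (hlift d f' g' v) \<noteq> 1"
    hence "absv (form d f' (v$1) (v$2)) < 1" "absv (form d g' (v$1) (v$2)) < 1"
      using red(2,4)[of d] by (auto simp: vnorm_def)
    hence "hlift d (reduce_poly f') (reduce_poly g') (vector [abs_residue (v$1), abs_residue (v$2)]) = 0"
      using red by (simp add: vec2_eq_0_iff abs_residue_eq_0_iff)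
    hence "abs_residue (v$1) = 0" "abs_residue (v$2) = 0"
      using nondegD(3)[OF nd, of "vector [abs_residue (v$1), abs_residue (v$2)]"]
      by (simp_all add: vec2_eq_0_iff)
    thus False using v v12 by (auto simp: abs_residue_eq_0_iff vnorm_def)
  qed
  hence "\<forall>v. vnorm v = 1 \<longrightarrow> vnorm (hlift d f g v) = inverse (absv c)"
    using absv_pos[OF c(1)] by (simp add: c hlift_smult vnorm_scale field_simps)
  thus "\<exists>C>0. \<forall>v. vnorm (hlift d f g v) = C * vnorm v ^ d"
    unfolding vnorm_hlift_iff[OF d(2)] using absv_pos[OF c(1)] by (intro exI[of _ "inverse (absv c)"]) simp
next
  assume "\<exists>C>0. \<forall>v. vnorm (hlift d f g v) = C * vnorm v ^ d"
  then obtain C where C: "C > 0" "\<And>v. vnorm (hlift d f g v) = C * vnorm v ^ d" by blast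
  have "g \<noteq> 0" using quot by (simp add: is_quot_def)
  then obtain c where c: "c \<noteq> 0" "integral_poly (smult c f)" "integral_poly (smult c g)"
    "\<exists>i. absv (coeff (smult c f) i) = 1 \<or> absv (coeff (smult c g) i) = 1"
    using exists_max_coeff[of f g] by metis
  define f' g' C' where "f' = smult c f" and "g' = smult c g" and "C' = absv c * C"
  have int: "integral_poly f'" "integral_poly g'" using c by (simp_all add: f'_def g'_def)
  have deg: "degree f' \<le> d" "degree g' \<le> d" using d by (auto simp: f'_def g'_def)
  have C': "vnorm (hlift d f' g' v) = C' * vnorm v ^ d" for v
    by (simp add: f'_def g'_def hlift_smult vnorm_scale C C'_def)
  \<comment> \<open>After normalization the constant is 1: integrality gives one bound, and the
    other holds because \<open>C'\<close> bounds both polynomials on the unit disk and hence all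
    their coefficients, one of which is a unit.\<close>
  have "C' \<le> 1"
    using C'[of "vector [1, 0]"] int by (auto simp: vnorm_def form_1_0 integral_poly_def)
  moreover have "C' \<ge> 1"
  proof -
    have "max (absv (poly f' t)) (absv (poly g' t)) \<le> C'" if "absv t \<le> 1" for t
      using C'[of "vector [t, 1]"] that deg by (simp add: vnorm_def form_1_right max_absorb2)
    hence "absv (coeff f' i) \<le> C'" "absv (coeff g' i) \<le> C'" for i
      by (auto intro!: absv_coeff_le)
    with c(4) show ?thesis unfolding f'_def g'_def by metis
  qed
  ultimately have "C' = 1" by simp
  have nd: "nondeg d (reduce_poly f') (reduce_poly g')"
    unfolding nondeg_def
  proof (intro conjI allI impI)
    fix r assume r: "hlift d (reduce_poly f') (reduce_poly g') r = 0"
    obtain x where x: "absv x \<le> 1" "abs_residue x = r$1" using abs_residue_surj .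
    obtain y where y: "absv y \<le> 1" "abs_residue y = r$2" using abs_residue_surj .
    note red = form_reduce[OF int(1) x(1) y(1), of d] form_reduce[OF int(2) x(1) y(1), of d]
    have "absv (form d f' x y) < 1" "absv (form d g' x y) < 1"
      using r x y red by (auto simp: vec2_eq_0_iff abs_residue_eq_0_iff)
    hence "vnorm (hlift d f' g' (vector [x, y])) < 1" by (simp add: vnorm_def)
    hence "vnorm (vector [x, y]) ^ d < 1" unfolding C' \<open>C' = 1\<close> by simp
    hence "vnorm (vector [x, y]) < 1"
      by (metis linorder_not_less one_le_power)
    thus "r = 0" using x y by (auto simp: vec2_eq_0_iff vnorm_def abs_residue_eq_0_iff simp flip: x(2) y(2))
  qed (use deg degree_reduce_poly_le[of f'] degree_reduce_poly_le[of g'] in auto)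
  have "is_quot \<phi> f' g'"
  proof -
    have "to_fract f' / to_fract g' = (to_fract [:c:] * to_fract f) / (to_fract [:c:] * to_fract g)"
      by (simp add: f'_def g'_def flip: to_fract_mult)
    also have "\<dots> = to_fract f / to_fract g" using c(1) by (intro mult_divide_mult_cancel_left) simp
    finally have "to_fract f' / to_fract g' = to_fract f / to_fract g" .
    moreover have "coprime f' g'"
      using quot c(1) by (auto simp: f'_def g'_def is_quot_def coprime_def dvd_smult_iff)
    ultimately show ?thesis using quot c(1) by (simp add: is_quot_def g'_def)
  qed
  moreover have "quot_degree (reduce_poly f') (reduce_poly g') = rat_degree \<phi>"
    using nondeg_imp[OF nd d(2)] d rat_degree_eq[OF quot]
      rat_degree_eq[of "to_fract (reduce_poly f') / to_fract (reduce_poly g')" "reduce_poly f'" "reduce_poly g'"]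
    by (simp add: quot_degree_def is_quot_def)
  ultimately show "good_reduction \<phi>"
    unfolding good_reduction_def using int c(4) unfolding f'_def g'_def by blast
qed

section \<open>Conjugation\<close>

lemma coeff_mult_top:
  fixes p q :: "'a::idom poly"
  assumes "degree p \<le> m" "degree q \<le> n"
  shows "coeff (p * q) (m + n) = coeff p m * coeff q n"
proof (cases "degree p = m \<and> degree q = n")
  case True
  thus ?thesis using coeff_mult_degree_sum[of p q] by simp
next
  case False
  hence "degree p + degree q < m + n" using assms by linarith
  hence "degree (p * q) < m + n" using degree_mult_le[of p q] by linarith
  moreover have "coeff p m = 0 \<or> coeff q n = 0"
    using False assms by (metis coeff_eq_0 le_neq_implies_less)
  ultimately show ?thesis by (auto simp: coeff_eq_0)
qed

lemma coeff_power_top: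
  fixes p :: "'a::idom poly"
  assumes "degree p \<le> 1"
  shows "coeff (p ^ n) n = coeff p 1 ^ n" "degree (p ^ n) \<le> n"
proof -
  have le: "degree (p ^ n) \<le> n" for n
  proof -
    have "degree (p ^ n) \<le> degree p * n" by (rule degree_power_le)
    also have "\<dots> \<le> 1 * n" using assms by (rule mult_right_mono) simp
    finally show ?thesis by simp
  qed
  show "degree (p ^ n) \<le> n" by (rule le)
  show "coeff (p ^ n) n = coeff p 1 ^ n"
  proof (induction n)
    case (Suc n)
    thus ?case using coeff_mult_top[OF assms le[of n]] by simp
  qed simp
qed

text \<open>The coefficient of index \<open>d\<close> is the value at infinity, a point that
  \<open>p\<close> and \<open>q\<close> send to their coefficients of index 1. This handles the case
  y = 0 in \<open>form_form_subst\<close>.\<close>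

lemma coeff_form_subst_top:
  fixes f :: "'a::field poly"
  assumes "degree p \<le> 1" "degree q \<le> 1"
  shows "coeff (form_subst d f p q) d = form d f (coeff p 1) (coeff q 1)"
proof -
  have "coeff (form_subst d f p q) d = (\<Sum>i\<le>d. coeff f i * coeff (p ^ i * q ^ (d - i)) d)"
    by (simp add: form_subst_def coeff_sum)
  also have "\<dots> = (\<Sum>i\<le>d. coeff f i * (coeff p 1 ^ i * coeff q 1 ^ (d - i)))"
  proof (intro sum.cong refl)
    fix i assume "i \<in> {..d}"
    thus "coeff f i * coeff (p ^ i * q ^ (d - i)) d = coeff f i * (coeff p 1 ^ i * coeff q 1 ^ (d - i))"
      using coeff_mult_top[of "p ^ i" i "q ^ (d - i)" "d - i", OF coeff_power_top(2) coeff_power_top(2)]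
        coeff_power_top(1)[OF assms(1), of i] coeff_power_top(1)[OF assms(2), of "d - i"] assms
      by simp
  qed
  finally show ?thesis by (simp add: form_def mult.assoc)
qed

lemma form_form_subst:
  fixes f :: "'a::field poly"
  assumes "degree p \<le> 1" "degree q \<le> 1"
  shows "form d (form_subst d f p q) x y = form d f (form 1 p x y) (form 1 q x y)"
proof (cases "y = 0")
  case True
  thus ?thesis
    using form_scale[of d f x "coeff p 1" "coeff q 1"] coeff_form_subst_top[OF assms, of d f]
    by (simp add: form_0_right)
next
  case False
  show ?thesis
    using assms False degree_form_subst_le[OF assms, of d f]
    by (simp add: form_nonzero poly_form_subst form_scale)
qed

lemma form_subst_linear_left:
  assumes "degree a \<le> 1"
  shows "form d (form_subst 1 a f g) x y = form 1 a (form d f x y) (form d g x y)"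
  unfolding form_subst_linear[OF assms] form_add form_smult by (simp add: form_def)

lemma form_linear: "form 1 [:b, a:] x y = a * x + b * y"
  by (simp add: form_def)

text \<open>An element of PGL is the case \<open>d = 1\<close> of a lift, so the facts about coprime
  representations and composition apply to \<open>pgl_rat\<close>.\<close>

lemma nondeg_matrix:
  assumes "invertible (A :: 'a::field^2^2)"
  shows "nondeg 1 [:A$1$2, A$1$1:] [:A$2$2, A$2$1:]"
    and "hlift 1 [:A$1$2, A$1$1:] [:A$2$2, A$2$1:] v = A *v v"
proof -
  show *: "hlift 1 [:A$1$2, A$1$1:] [:A$2$2, A$2$1:] v = A *v v" for v
    by (simp add: vec2_eq_iff matrix_vector_mult_2 hlift_nth form_linear del: One_nat_def)
  show "nondeg 1 [:A$1$2, A$1$1:] [:A$2$2, A$2$1:]"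
    unfolding nondeg_def *
  proof (intro conjI allI impI)
    obtain B where "B ** A = mat 1" using assms by (auto simp: invertible_def)
    fix v :: "'a^2" assume "A *v v = 0"
    hence "(B ** A) *v v = 0" by (simp flip: matrix_vector_mul_assoc)
    thus "v = 0" using \<open>B ** A = mat 1\<close> by simp
  qed (simp_all)
qed

lemma matrix_inv_cancel:
  assumes "invertible (A :: 'a::field^2^2)"
  shows "A *v (matrix_inv A *v v) = v" "matrix_inv A *v (A *v v) = v"
proof -
  obtain B where B: "A ** B = mat 1" "B ** A = mat 1" using assms by (auto simp: invertible_def)
  have "matrix_inv A = B" by (rule matrix_inv_eqI[OF B(1)])
  thus "A *v (matrix_inv A *v v) = v" "matrix_inv A *v (A *v v) = v"
    using B by (simp_all add: matrix_vector_mul_assoc)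
qed

lemma invertible_matrix_inv: "invertible (A :: 'a::field^2^2) \<Longrightarrow> invertible (matrix_inv A)"
  unfolding invertible_def by (metis matrix_inv_eqI)

lemma pgl_rel_refl: "invertible A \<Longrightarrow> pgl_rel A A"
  by (auto simp: pgl_rel_def scale_matrix_def vec_eq_iff intro: exI[of _ 1])

lemma nondeg_is_quot:
  fixes f g :: "'a::alg_closed_field poly"
  assumes "nondeg d f g" "d > 0"
  shows "is_quot (to_fract f / to_fract g) f g"
  using nondeg_imp[OF assms] by (simp add: is_quot_def)

text \<open>The lift of the conjugate is A T A^-1. Reading off each composition needs a coprime
  representation of the outer function, so nondegeneracy is carried along from \<open>a1\<close>,
  \<open>a2\<close> to \<open>f1\<close>, \<open>g1\<close> and \<open>f2\<close>,
  \<open>g2\<close>.\<close>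

lemma pgl_conj_lift:
  fixes f g :: "'a::alg_closed_field poly"
  assumes A: "invertible A" and quot: "is_quot \<phi> f g" and d: "max (degree f) (degree g) = d" "d > 0"
  obtains f' g' where "is_quot (pgl_conj (abs_pgl2 A) \<phi>) f' g'" "max (degree f') (degree g') = d"
    "\<And>v. hlift d f' g' v = A *v hlift d f g (matrix_inv A *v v)"
proof -
  define B where "B = matrix_inv A"
  define a1 a2 b1 b2 where "a1 = [:A$1$2, A$1$1:]" and "a2 = [:A$2$2, A$2$1:]"
    and "b1 = [:B$1$2, B$1$1:]" and "b2 = [:B$2$2, B$2$1:]"
  have B: "invertible B" using A by (simp add: B_def invertible_matrix_inv)
  have deg: "degree a1 \<le> 1" "degree a2 \<le> 1" "degree b1 \<le> 1" "degree b2 \<le> 1"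
    by (simp_all add: a1_def a2_def b1_def b2_def)
  have nda: "nondeg 1 a1 a2" "\<And>v. hlift 1 a1 a2 v = A *v v"
    and ndb: "nondeg 1 b1 b2" "\<And>v. hlift 1 b1 b2 v = B *v v"
    using nondeg_matrix[OF A] nondeg_matrix[OF B] by (simp_all only: a1_def a2_def b1_def b2_def)
  have nd: "nondeg d f g" using quot d by (intro nondegI) (simp_all add: is_quot_def)
  have r: "pgl_rat (abs_pgl2 A) = to_fract a1 / to_fract a2"
    "pgl_rat (pgl_inv (abs_pgl2 A)) = to_fract b1 / to_fract b2"
    using pgl_rel_refl[OF A] pgl_rel_refl[OF B]
    by (simp_all add: pgl_rat.abs_eq pgl_inv.abs_eq a1_def a2_def b1_def b2_def B_def)
  define f1 g1 where "f1 = form_subst 1 a1 f g" and "g1 = form_subst 1 a2 f g"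
  have g: "g \<noteq> 0" "\<phi> = to_fract f / to_fract g" using quot by (auto simp: is_quot_def)
  have c1: "rat_comp (pgl_rat (abs_pgl2 A)) \<phi> = to_fract f1 / to_fract g1"
    unfolding r g(2) f1_def g1_def
    by (rule rat_comp_fract[OF nondeg_is_quot[OF nda(1)] deg(1,2) g(1)]) simp
  have h1: "hlift d f1 g1 v = A *v hlift d f g v" for v
    unfolding f1_def g1_def nda(2)[symmetric] using deg(1,2)
    by (simp add: vec2_eq_iff form_subst_linear_left del: One_nat_def)
  have "A *v v = 0 \<Longrightarrow> v = 0" for v using nondegD(3)[OF nda(1)] nda(2) by simp
  moreover have "degree f1 \<le> d" "degree g1 \<le> d"
    unfolding f1_def g1_def form_subst_linear[OF deg(1)] form_subst_linear[OF deg(2)]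
    using nondegD(1,2)[OF nd] by (auto intro!: degree_add_le order_trans[OF degree_smult_le])
  ultimately have nd1: "nondeg d f1 g1"
    unfolding nondeg_def h1 using nondegD(3)[OF nd] by blast
  define f2 g2 where "f2 = form_subst d f1 b1 b2" and "g2 = form_subst d g1 b1 b2"
  have "b2 \<noteq> 0" using nondeg_imp[OF ndb(1)] by simp
  have "rat_comp (to_fract f1 / to_fract g1) (to_fract b1 / to_fract b2) = to_fract f2 / to_fract g2"
    unfolding f2_def g2_def using nondegD(1,2)[OF nd1] \<open>b2 \<noteq> 0\<close>
    by (intro rat_comp_fract nondeg_is_quot[OF nd1 d(2)]) 
  hence conj: "pgl_conj (abs_pgl2 A) \<phi> = to_fract f2 / to_fract g2"
    by (simp add: pgl_conj_def c1 r(2))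
  have h2: "hlift d f2 g2 v = A *v hlift d f g (B *v v)" for v
    unfolding h1[symmetric] ndb(2)[symmetric] f2_def g2_def using deg
    by (simp add: vec2_eq_iff form_form_subst hlift_def)
  have "B *v v = 0 \<Longrightarrow> v = 0" for v using nondegD(3)[OF ndb(1)] ndb(2) by simp
  moreover have "A *v v = 0 \<Longrightarrow> v = 0" for v by fact
  ultimately have "hlift d f2 g2 v = 0 \<Longrightarrow> v = 0" for v
    unfolding h2 using nondegD(3)[OF nd] by blast
  hence nd2: "nondeg d f2 g2"
    using degree_form_subst_le[OF deg(3,4)] by (simp add: nondeg_def f2_def g2_def)
  show thesis
    by (rule that[of f2 g2]) (use conj h2 nondeg_is_quot[OF nd2 d(2)] nondeg_imp[OF nd2 d(2)] in \<open>simp_all add: B_def\<close>)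
qed

text \<open>Substituting \<open>A *v v\<close> for the vector cancels the inverse matrix, so
  conjugation becomes a change of norm.\<close>

lemma good_reduction_pgl_conj_iff:
  fixes f g :: "'a::{alg_closed_field, nonarch_field} poly"
  assumes A: "invertible A" and quot: "is_quot \<phi> f g" and d: "max (degree f) (degree g) = d" "d > 0"
  shows "good_reduction (pgl_conj (abs_pgl2 A) \<phi>) \<longleftrightarrow>
    (\<exists>C>0. \<forall>v. vnorm (A *v hlift d f g v) = C * vnorm (A *v v) ^ d)"
proof -
  obtain f' g' where fg: "is_quot (pgl_conj (abs_pgl2 A) \<phi>) f' g'" "max (degree f') (degree g') = d"
    "\<And>v. hlift d f' g' v = A *v hlift d f g (matrix_inv A *v v)"
    by (rule pgl_conj_lift[OF assms]) blast
  have "(\<forall>v. vnorm (hlift d f' g' v) = C * vnorm v ^ d) \<longleftrightarrow>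
      (\<forall>v. vnorm (A *v hlift d f g v) = C * vnorm (A *v v) ^ d)" for C
    unfolding fg(3)
  proof safe
    fix v assume "\<forall>v. vnorm (A *v hlift d f g (matrix_inv A *v v)) = C * vnorm v ^ d"
    from spec[OF this, of "A *v v"] show "vnorm (A *v hlift d f g v) = C * vnorm (A *v v) ^ d"
      by (simp only: matrix_inv_cancel[OF A])
  next
    fix v assume "\<forall>v. vnorm (A *v hlift d f g v) = C * vnorm (A *v v) ^ d"
    from spec[OF this, of "matrix_inv A *v v"]
    show "vnorm (A *v hlift d f g (matrix_inv A *v v)) = C * vnorm v ^ d"
      by (simp only: matrix_inv_cancel[OF A])
  qed
  thus ?thesis unfolding good_reduction_iff[OF fg(1,2) d(2)] by simp
qed

lemma pgl_cases:
  obtains A where "invertible A" "h = abs_pgl2 A"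
proof -
  have "pgl_rel (rep_pgl2 h) (rep_pgl2 h)" "abs_pgl2 (rep_pgl2 h) = h"
    by (rule Quotient3_rep_reflp[OF Quotient3_pgl2], rule Quotient3_abs_rep[OF Quotient3_pgl2])
  thus thesis using that by (auto simp: pgl_rel_def)
qed

section \<open>Points of the projective line\<close>

text \<open>The zero vector is sent to \<open>Infty\<close> by default, hence the assumptions
  \<open>v \<noteq> 0\<close> later on.\<close>

definition pt :: "'a::field^2 \<Rightarrow> 'a proj_line"
  where "pt v = (if v$2 = 0 then Infty else Aff (v$1 / v$2))"

definition vec_of :: "'a::field proj_line \<Rightarrow> 'a^2"
  where "vec_of p = (case p of Aff a \<Rightarrow> vector [a, 1] | Infty \<Rightarrow> vector [1, 0])"

lemma vec_of_simps [simp]: "vec_of (Aff a) = vector [a, 1]" "vec_of Infty = vector [1, 0]"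
  by (simp_all add: vec_of_def)

lemma vec_of_nonzero [simp]: "vec_of p \<noteq> 0"
  by (cases p) (simp_all add: vec2_eq_0_iff)

lemma pt_vec_of [simp]: "pt (vec_of p) = p"
  by (cases p) (simp_all add: pt_def)

lemma det2_swap: "det2 w v = - det2 v w"
  by (simp add: det2_def)

lemma det2_self [simp]: "det2 v v = 0"
  by (simp add: det2_def)

lemma det2_scale: "det2 (c *s v) w = c * det2 v w" "det2 v (c *s w) = c * det2 v w"
  by (simp_all add: det2_def algebra_simps)

lemma det2_add_right: "det2 u (v + w) = det2 u v + det2 u w"
  by (simp add: det2_def algebra_simps)

lemma det2_0 [simp]: "det2 0 v = 0" "det2 v 0 = 0"
  by (simp_all add: det2_def)

text \<open>Cramer's rule with the denominator cleared: it expresses \<open>u\<close> in the basis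
  \<open>v\<close>, \<open>w\<close>.\<close>

lemma det2_cramer: "det2 v w *s u = det2 u w *s v + det2 v u *s w"
  by (simp add: vec2_eq_iff det2_def algebra_simps)

lemma det2_eq_0_iff:
  assumes "(v :: 'a::field^2) \<noteq> 0"
  shows "det2 v w = 0 \<longleftrightarrow> (\<exists>c. w = c *s v)"
proof
  assume *: "det2 v w = 0"
  show "\<exists>c. w = c *s v"
  proof (cases "v$1 = 0")
    case True
    hence "v$2 \<noteq> 0" using assms by (simp add: vec2_eq_0_iff)
    thus ?thesis using * True
      by (intro exI[of _ "w$2 / v$2"]) (auto simp: vec2_eq_iff det2_def)
  next
    case False
    thus ?thesis using *
      by (intro exI[of _ "w$1 / v$1"]) (auto simp: vec2_eq_iff det2_def field_simps)
  qed
qed (auto simp: det2_scale)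

lemma pt_eq_iff:
  assumes "v \<noteq> 0" "w \<noteq> 0"
  shows "pt v = pt w \<longleftrightarrow> det2 v w = 0"
  using assms by (auto simp: pt_def det2_def vec2_eq_0_iff field_simps)

lemma pgl_apply_pt:
  assumes "invertible A" "v \<noteq> 0"
  shows "pgl_apply (abs_pgl2 A) (pt v) = pt (A *v v)"
proof -
  have *: "A $ i $ 1 * (v$1 / v$2) + A $ i $ 2 = (A *v v) $ i / v$2" if "v$2 \<noteq> 0" for i
    using that by (simp add: matrix_vector_mult_2 field_simps)
  have "matrix_apply A (pt v) = pt (A *v v)"
  proof (cases "v$2 = 0")
    case True
    hence "v$1 \<noteq> 0" using assms(2) by (simp add: vec2_eq_0_iff)
    thus ?thesis using True by (simp add: pt_def matrix_apply_def matrix_vector_mult_2)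
  next
    case False
    thus ?thesis by (simp add: pt_def matrix_apply_def * del: times_divide_eq_right)
  qed
  thus ?thesis using pgl_rel_refl[OF assms(1)] by (simp add: pgl_apply.abs_eq)
qed

lemma rat_apply_pt:
  assumes "rat_degree \<phi> = d" "v \<noteq> 0"
  shows "rat_apply \<phi> (pt v) = pt (hlift d (rat_num \<phi>) (rat_den \<phi>) v)"
proof -
  have deg: "degree (rat_num \<phi>) \<le> d" "degree (rat_den \<phi>) \<le> d"
    using assms(1) by (auto simp: rat_degree_def)
  show ?thesis
  proof (cases "v$2 = 0")
    case True
    hence "v$1 \<noteq> 0" using assms(2) by (simp add: vec2_eq_0_iff)
    thus ?thesis using True assms(1) by (simp add: pt_def rat_apply_def form_0_right Let_def)
  next
    case False
    thus ?thesis using deg by (simp add: pt_def rat_apply_def form_nonzero)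
  qed
qed

section \<open>Multipliers\<close>

text \<open>With \<open>form_dy\<close>, the formal partial derivatives of \<open>form\<close>.
  Truncated exponents (\<open>i = 0\<close> here, \<open>i = d\<close> there) come with a zero
  factor.\<close>

definition form_dx :: "nat \<Rightarrow> 'a::comm_ring_1 poly \<Rightarrow> 'a \<Rightarrow> 'a \<Rightarrow> 'a"
  where "form_dx d f x y = (\<Sum>i\<le>d. coeff f i * (of_nat i * x ^ (i - 1) * y ^ (d - i)))"

definition form_dy :: "nat \<Rightarrow> 'a::comm_ring_1 poly \<Rightarrow> 'a \<Rightarrow> 'a \<Rightarrow> 'a"
  where "form_dy d f x y = (\<Sum>i\<le>d. coeff f i * (of_nat (d - i) * x ^ i * y ^ (d - i - 1)))"

lemma coeff_0_power_linear: "coeff ([:x, w:] ^ n) 0 = x ^ n"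
  for x w :: "'a::comm_ring_1"
  by (simp add: coeff_0_power)

lemma coeff_1_mult: "coeff (p * q) (Suc 0) = coeff p 0 * coeff q (Suc 0) + coeff p (Suc 0) * coeff q 0"
  by (simp add: coeff_mult)

lemma coeff_1_power_linear: "coeff ([:x, w:] ^ n) (Suc 0) = of_nat n * x ^ (n - 1) * w"
  for x w :: "'a::comm_ring_1"
proof (induction n)
  case (Suc n)
  thus ?case
    by (cases n) (simp_all add: coeff_1_mult coeff_0_power_linear algebra_simps)
qed simp

text \<open>The chain rule at t = 0 along the line (x + t a, y + t b).\<close>

lemma coeff_1_form_subst:
  "coeff (form_subst d f [:x, a:] [:y, b:]) (Suc 0) = form_dx d f x y * a + form_dy d f x y * b"
proof -
  have "coeff (form_subst d f [:x, a:] [:y, b:]) (Suc 0) =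
      (\<Sum>i\<le>d. coeff f i * (of_nat i * x ^ (i - 1) * y ^ (d - i)) * a +
              coeff f i * (of_nat (d - i) * x ^ i * y ^ (d - i - 1)) * b)"
    unfolding form_subst_def coeff_sum
    by (intro sum.cong refl)
       (simp add: coeff_1_mult coeff_0_power_linear coeff_1_power_linear algebra_simps)
  thus ?thesis by (simp add: form_dx_def form_dy_def sum.distrib sum_distrib_right)
qed

text \<open>Euler's identity for homogeneous forms. It recovers the second partial derivative at (a,
  1) from the first, an ordinary derivative by \<open>form_dx_1_right\<close>.\<close>

lemma form_euler: "x * form_dx d f x y + y * form_dy d f x y = of_nat d * form d f x y"
proof -
  have *: "x * (of_nat i * x ^ (i - 1)) = of_nat i * x ^ i" for i and x :: 'a
    by (cases i) simp_all
  have "x * (coeff f i * (of_nat i * x ^ (i - 1) * y ^ (d - i))) +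
      y * (coeff f i * (of_nat (d - i) * x ^ i * y ^ (d - i - 1))) =
      of_nat d * (coeff f i * x ^ i * y ^ (d - i))" if "i \<le> d" for i
  proof -
    have "x * (coeff f i * (of_nat i * x ^ (i - 1) * y ^ (d - i))) +
      y * (coeff f i * (of_nat (d - i) * x ^ i * y ^ (d - i - 1))) =
      coeff f i * y ^ (d - i) * (x * (of_nat i * x ^ (i - 1))) +
      coeff f i * x ^ i * (y * (of_nat (d - i) * y ^ (d - i - 1)))"
      by (simp only: mult_ac)
    also have "\<dots> = (of_nat i + of_nat (d - i)) * (coeff f i * x ^ i * y ^ (d - i))"
      unfolding * by (simp only: distrib_left distrib_right mult_ac)
    finally show ?thesis using that by (simp flip: of_nat_add)
  qed
  thus ?thesis
    by (simp add: form_dx_def form_dy_def form_def sum_distrib_left flip: sum.distrib)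
qed

lemma pderiv_sum: "pderiv (\<Sum>i\<in>A. f i) = (\<Sum>i\<in>A. pderiv (f i))"
  by (induction A rule: infinite_finite_induct) (simp_all add: pderiv_add)

lemma form_dx_1_right:
  assumes "degree f \<le> d"
  shows "form_dx d f x 1 = poly (pderiv f) x"
proof -
  have "pderiv f = pderiv (\<Sum>i\<le>d. monom (coeff f i) i)"
    by (simp add: poly_as_sum_of_monoms'[OF assms])
  also have "\<dots> = (\<Sum>i\<le>d. monom (of_nat i * coeff f i) (i - 1))"
    by (simp add: pderiv_sum pderiv_monom)
  finally show ?thesis
    by (simp add: form_dx_def poly_sum poly_monom mult_ac)
qed

lemma form_dy_1_0:
  assumes "d > 0"
  shows "form_dy d f 1 0 = coeff f (d - 1)"
proof -
  have "form_dy d f 1 0 = (\<Sum>i\<le>d. if i = d - 1 then coeff f i else 0)"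
    unfolding form_dy_def
  proof (intro sum.cong refl)
    fix i assume "i \<in> {..d}"
    hence "i = d - 1 \<or> i = d \<or> d - i - 1 > 0" by auto
    thus "coeff f i * (of_nat (d - i) * 1 ^ i * 0 ^ (d - i - 1)) = (if i = d - 1 then coeff f i else 0)"
      using assms by (auto simp: power_0_left)
  qed
  thus ?thesis by simp
qed

text \<open>Values may be computed from an unreduced fraction such as the one defining
  \<open>rat_deriv\<close>: if the reduced denominator vanished at \<open>a\<close> while
  \<open>q\<close> does not, so would the reduced numerator.\<close>

lemma rat_value_fract:
  assumes "\<phi> = to_fract p / to_fract q" "poly q a \<noteq> 0"
  shows "rat_value \<phi> a = poly p a / poly q a"
proof -
  define n m where "n = rat_num \<phi>" and "m = rat_den \<phi>"
  have nm: "coprime n m" "m \<noteq> 0" "\<phi> = to_fract n / to_fract m"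
    using is_quot_rat_num_den[of \<phi>] by (auto simp: is_quot_def n_def m_def)
  have "q \<noteq> 0" using assms by auto
  hence "to_fract (p * m) = to_fract (n * q)"
    using nm assms by (auto simp: field_simps)
  hence "p * m = n * q" by (simp only: to_fract_eq_iff)
  hence eq: "poly p a * poly m a = poly n a * poly q a" by (metis poly_mult)
  have "poly m a \<noteq> 0"
  proof
    assume "poly m a = 0"
    hence "[:- a, 1:] dvd m" "[:- a, 1:] dvd n" using eq assms by (auto simp: poly_eq_0_iff_dvd)
    hence "is_unit [:- a, 1:]" using nm coprime_common_divisor by blast
    thus False by (simp add: is_unit_poly_iff)
  qed
  thus ?thesis using eq assms by (simp add: rat_value_def field_simps n_def m_def)
qed

lemma rat_value_rat_deriv:
  assumes "is_quot \<phi> f g" "poly g a \<noteq> 0"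
  shows "rat_value (rat_deriv \<phi>) a =
    (poly (pderiv f) a * poly g a - poly f a * poly (pderiv g) a) / poly g a ^ 2"
proof -
  obtain c where c: "c \<noteq> 0" "rat_num \<phi> = smult c f" "rat_den \<phi> = smult c g"
    using is_quot_unique[OF assms(1) is_quot_rat_num_den] .
  have "rat_value (rat_deriv \<phi>) a =
      poly (pderiv (rat_num \<phi>) * rat_den \<phi> - rat_num \<phi> * pderiv (rat_den \<phi>)) a / poly ((rat_den \<phi>)\<^sup>2) a"
    using assms(2) c by (intro rat_value_fract) (simp_all add: rat_deriv_def)
  also have "\<dots> = (c^2 * (poly (pderiv f) a * poly g a - poly f a * poly (pderiv g) a)) / (c^2 * poly g a ^ 2)"
    by (simp add: c pderiv_smult power2_eq_square algebra_simps)
  also have "\<dots> = (poly (pderiv f) a * poly g a - poly f a * poly (pderiv g) a) / poly g a ^ 2"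
    using c(1) by simp
  finally show ?thesis .
qed

text \<open>The map z -> 1/z exchanges the homogeneous coordinates, so \<open>f'\<close> and
  \<open>g'\<close> are \<open>f\<close> and \<open>g\<close> with coefficients read backwards from
  index \<open>d\<close>; the outer reciprocal exchanges their roles.\<close>

lemma rat_flip_fract:
  fixes f g :: "'a::alg_closed_field poly"
  assumes "is_quot \<phi> f g" "max (degree f) (degree g) = d" "d > 0"
  defines "f' \<equiv> form_subst d f [:1, 0:] [:0, 1:]" and "g' \<equiv> form_subst d g [:1, 0:] [:0, 1:]"
  shows "is_quot (rat_flip \<phi>) g' f'" "max (degree g') (degree f') = d"
proof -
  have "rat_comp \<phi> (to_fract [:1, 0:] / to_fract [:0, 1:]) = to_fract f' / to_fract g'"
    unfolding f'_def g'_def using assms(2) by (intro rat_comp_fract[OF assms(1)]) auto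
  moreover have "to_fract [:1, 0 :: 'a:] = 1" by (simp flip: one_pCons)
  ultimately have flip: "rat_flip \<phi> = to_fract g' / to_fract f'"
    by (simp only: rat_flip_def rat_X_def divide_divide_eq_right mult_1)
  have nd: "nondeg d f g" using assms by (intro nondegI) (auto simp: is_quot_def)
  have "hlift d g' f' v = vector [hlift d f g (vector [v$2, v$1]) $ 2, hlift d f g (vector [v$2, v$1]) $ 1]" for v
    unfolding g'_def f'_def by (simp add: vec2_eq_iff form_form_subst form_linear del: One_nat_def pCons_0_0)
  hence "v = 0" if "hlift d g' f' v = 0" for v
    using nondegD(3)[OF nd, of "vector [v$2, v$1]"] that by (simp add: vec2_eq_0_iff)
  hence nd': "nondeg d g' f'"
    by (auto simp: nondeg_def g'_def f'_def intro!: degree_form_subst_le)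
  show "is_quot (rat_flip \<phi>) g' f'" "max (degree g') (degree f') = d"
    unfolding flip using nondeg_is_quot[OF nd' assms(3)] nondeg_imp[OF nd' assms(3)] by simp_all
qed

text \<open>
  The polynomial \<open>t \<mapsto> det (u, T (v + t w))\<close>, where \<open>T\<close> is the homogeneous lift. If \<open>v\<close> spans
  a fixed line, \<open>T v = \<mu> v\<close>, then the linear coefficient for \<open>u = v\<close> is the multiplier
  times \<open>\<mu> det (v, w)\<close>; this description is independent of coordinates.
\<close>

definition line_poly :: "nat \<Rightarrow> 'a::field poly \<Rightarrow> 'a poly \<Rightarrow> 'a^2 \<Rightarrow> 'a^2 \<Rightarrow> 'a^2 \<Rightarrow> 'a poly"
  where "line_poly d f g u v w =
    smult (u$1) (form_subst d g [:v$1, w$1:] [:v$2, w$2:]) -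
    smult (u$2) (form_subst d f [:v$1, w$1:] [:v$2, w$2:])"

lemma poly_line_poly: "poly (line_poly d f g u v w) t = det2 u (hlift d f g (v + t *s w))"
  by (simp add: line_poly_def poly_form_subst det2_def mult.commute[of t])

lemma coeff_1_line_poly:
  "coeff (line_poly d f g u v w) (Suc 0) =
    u$1 * (form_dx d g (v$1) (v$2) * w$1 + form_dy d g (v$1) (v$2) * w$2) -
    u$2 * (form_dx d f (v$1) (v$2) * w$1 + form_dy d f (v$1) (v$2) * w$2)"
  by (simp add: line_poly_def coeff_1_form_subst)

definition line_multiplier :: "nat \<Rightarrow> 'a::field poly \<Rightarrow> 'a poly \<Rightarrow> 'a^2 \<Rightarrow> 'a \<Rightarrow> bool"
  where "line_multiplier d f g v \<kappa> \<longleftrightarrow> (\<exists>\<mu>. \<mu> \<noteq> 0 \<and> hlift d f g v = \<mu> *s v \<and>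
    (\<forall>w. coeff (line_poly d f g v v w) (Suc 0) = \<kappa> * \<mu> * det2 v w))"

text \<open>On the affine chart f(a) = a g(a) simplifies the quotient rule. At infinity, both the
  linear coefficient along the line and the derivative of the flipped map at 0 come from the
  coefficient of \<open>g\<close> of index \<open>d - 1\<close>.\<close>

lemma line_multiplier_multiplier:
  fixes \<phi> :: "'a::alg_closed_field poly fract"
  assumes d: "rat_degree \<phi> = d" "d > 0" and fixed: "is_fixed_point \<phi> p"
  shows "line_multiplier d (rat_num \<phi>) (rat_den \<phi>) (vec_of p) (multiplier \<phi> p)"
proof -
  define f g where "f = rat_num \<phi>" and "g = rat_den \<phi>"
  have quot: "is_quot \<phi> f g" unfolding f_def g_def by (rule is_quot_rat_num_den)
  have deg: "max (degree f) (degree g) = d" using rat_degree_eq[OF quot] d by simp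
  hence deg': "degree f \<le> d" "degree g \<le> d" by auto
  have "line_multiplier d f g (vec_of p) (multiplier \<phi> p)"
  proof (cases p)
    case (Aff a)
    define \<mu> where "\<mu> = poly g a"
    have \<mu>: "\<mu> \<noteq> 0" "poly f a = a * \<mu>"
      using fixed Aff by (auto simp: is_fixed_point_def rat_apply_def \<mu>_def f_def g_def field_simps split: if_splits)
    have "hlift d f g (vec_of p) = \<mu> *s vec_of p"
      using deg' \<mu> by (simp add: Aff vec2_eq_iff form_1_right) (simp add: \<mu>_def)
    moreover have "coeff (line_poly d f g (vec_of p) (vec_of p) w) (Suc 0) =
        multiplier \<phi> p * \<mu> * det2 (vec_of p) w" for w
    proof -
      have "multiplier \<phi> p * \<mu> = poly (pderiv f) a - a * poly (pderiv g) a"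
      proof -
        have "multiplier \<phi> p = (\<mu> * (poly (pderiv f) a - a * poly (pderiv g) a)) / (\<mu> * \<mu>)"
          using rat_value_rat_deriv[OF quot, of a] \<mu>
          by (simp add: Aff multiplier_def \<mu>_def[symmetric] power2_eq_square algebra_simps)
        also have "\<dots> = (poly (pderiv f) a - a * poly (pderiv g) a) / \<mu>"
          using \<mu>(1) by (rule nonzero_mult_divide_mult_cancel_left)
        finally show ?thesis using \<mu>(1) by simp
      qed
      \<comment> \<open>Inserted into the linear coefficient of the line polynomial, the terms with
        \<open>of_nat d\<close> cancel.\<close>
      moreover have dy: "form_dy d f a 1 = of_nat d * (a * \<mu>) - a * poly (pderiv f) a"
        "form_dy d g a 1 = of_nat d * \<mu> - a * poly (pderiv g) a"
        using form_euler[of a d f 1] form_euler[of a d g 1] deg' \<mu>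
        by (simp_all add: form_dx_1_right form_1_right \<mu>_def[symmetric] algebra_simps)
      ultimately have "multiplier \<phi> p * \<mu> * det2 (vec_of p) w =
          (poly (pderiv f) a - a * poly (pderiv g) a) * (a * w$2 - w$1)"
        by (simp add: Aff det2_def)
      thus ?thesis
        using deg' by (simp add: coeff_1_line_poly Aff form_dx_1_right dy) (simp add: algebra_simps)
    qed
    ultimately show ?thesis using \<mu> unfolding line_multiplier_def by blast
  next
    case Infty
    define \<mu> where "\<mu> = coeff f d"
    have gd: "coeff g d = 0"
      using fixed Infty d by (auto simp: is_fixed_point_def rat_apply_def g_def Let_def split: if_splits)
    have nd: "nondeg d f g" using quot deg d by (intro nondegI) (auto simp: is_quot_def)
    have h: "hlift d f g (vec_of p) = \<mu> *s vec_of p"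
      using gd by (simp add: Infty vec2_eq_iff form_1_0 \<mu>_def)
    have "\<mu> \<noteq> 0" using nondegD(3)[OF nd, of "vec_of p"] h by auto
    define f' g' where "f' = form_subst d f [:1, 0:] [:0, 1:]" and "g' = form_subst d g [:1, 0:] [:0, 1:]"
    have quot': "is_quot (rat_flip \<phi>) g' f'"
      unfolding f'_def g'_def by (rule rat_flip_fract(1)[OF quot deg d(2)])
    have vals: "poly f' 0 = \<mu>" "poly g' 0 = 0"
      by (simp_all add: f'_def g'_def poly_form_subst form_1_0 gd \<mu>_def)
    have "poly (pderiv g') 0 = coeff g (d - 1)"
      using coeff_1_form_subst[of d g 1 0 0 1] d
      by (simp add: poly_0_coeff_0 coeff_pderiv g'_def form_dy_1_0)
    hence "multiplier \<phi> p * \<mu> = coeff g (d - 1)"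
      using rat_value_rat_deriv[OF quot', of 0] vals \<open>\<mu> \<noteq> 0\<close>
      by (simp add: multiplier_def Infty power2_eq_square)
    moreover have "form_dx d g 1 0 = 0"
      using form_euler[of 1 d g 0] by (simp add: form_1_0 gd)
    ultimately have "coeff (line_poly d f g (vec_of p) (vec_of p) w) (Suc 0) =
        multiplier \<phi> p * \<mu> * det2 (vec_of p) w" for w
      using d by (simp add: coeff_1_line_poly Infty form_dy_1_0 det2_def)
    with h \<open>\<mu> \<noteq> 0\<close> show ?thesis unfolding line_multiplier_def by blast
  qed
  thus ?thesis by (simp only: f_def g_def)
qed

section \<open>Multiple fixed points\<close>

lemma multiple_fixed_point_deriv:
  assumes quot: "is_quot \<phi> f g" and deg: "rat_degree \<phi> \<ge> 2"
    and mult: "rat_order a (\<phi> - rat_X) \<ge> 2"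
  shows "rat_value (rat_deriv \<phi>) a = 1"
proof -
  \<comment> \<open>\<open>h\<close> is the numerator of \<phi>(z) - z in lowest terms; it vanishes
    to order at least 2 at \<open>a\<close>.\<close>
  define h where "h = f - [:0, 1:] * g"
  have g: "g \<noteq> 0" "coprime f g" "\<phi> = to_fract f / to_fract g" using quot by (auto simp: is_quot_def)
  \<comment> \<open>Otherwise \<phi> would be the identity, of degree 1.\<close>
  have "h \<noteq> 0"
  proof
    assume "h = 0"
    hence f: "f = [:0, 1:] * g" by (simp add: h_def)
    hence "g dvd f" using dvd_triv_right by metis
    hence "is_unit g" using g(2) by (metis coprime_common_divisor dvd_refl)
    hence "degree g = 0" using is_unit_iff_degree[OF g(1)] by simp
    hence "rat_degree \<phi> \<le> 1"
      unfolding rat_degree_eq[OF quot] f by (simp add: degree_mult_eq g(1))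
    with deg show False by simp
  qed
  have "coprime h g"
  proof (rule coprimeI)
    fix c assume c: "c dvd h" "c dvd g"
    hence "c dvd h + [:0, 1:] * g" by (intro dvd_add dvd_mult)
    hence "c dvd f" by (simp add: h_def)
    with c g(2) show "is_unit c" by (metis coprime_common_divisor)
  qed
  moreover have "to_fract h = to_fract f - rat_X * to_fract g"
    unfolding h_def rat_X_def by (simp only: to_fract_diff to_fract_mult)
  ultimately have "is_quot (\<phi> - rat_X) h g"
    using g by (simp add: is_quot_def diff_divide_distrib)
  then obtain c where c: "c \<noteq> 0" "rat_num (\<phi> - rat_X) = smult c h" "rat_den (\<phi> - rat_X) = smult c g"
    using is_quot_unique is_quot_rat_num_den by metis
  have ord: "order a h \<ge> 2" using mult c(1) by (simp add: rat_order_def c order_smult)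
  hence "[:- a, 1:] ^ 2 dvd h" using order_divides by blast
  then obtain k where k: "h = [:- a, 1:] ^ 2 * k" by (auto elim: dvdE)
  have h0: "poly h a = 0" by (simp add: k)
  have "poly [:- a, 1:] a = 0" by simp
  hence h1: "poly (pderiv h) a = 0"
    unfolding k power2_eq_square pderiv_mult poly_add poly_mult by (simp only:) simp
  have ga: "poly g a \<noteq> 0"
  proof
    assume "poly g a = 0"
    hence "[:- a, 1:] dvd g" "[:- a, 1:] dvd h" using h0 by (auto simp: poly_eq_0_iff_dvd)
    hence "is_unit [:- a, 1:]" using \<open>coprime h g\<close> coprime_common_divisor by blast
    thus False by (simp add: is_unit_poly_iff)
  qed
  have "poly f a = a * poly g a" using h0 by (simp add: h_def)
  moreover have "poly (pderiv f) a = poly g a + a * poly (pderiv g) a"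
    using h1 by (simp add: h_def pderiv_diff pderiv_mult pderiv_pCons algebra_simps)
  ultimately show ?thesis
    unfolding rat_value_rat_deriv[OF quot ga] using ga by (simp add: power2_eq_square field_simps)
qed

text \<open>A repeated fixed point is thus indifferent, which makes attracting ones simple. At
  infinity, multiplicity and multiplier are both defined through \<open>rat_flip\<close>, so the
  affine case applies to the flipped map at 0.\<close>

lemma multiple_fixed_point:
  fixes \<phi> :: "'a::alg_closed_field poly fract"
  assumes "rat_degree \<phi> \<ge> 2" "fixed_multiplicity \<phi> p \<ge> 2"
  shows "multiplier \<phi> p = 1"
proof (cases p)
  case (Aff a)
  thus ?thesis
    using assms multiple_fixed_point_deriv[OF is_quot_rat_num_den, of \<phi> a]
    by (simp add: fixed_multiplicity_def multiplier_def)
next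
  case Infty
  note quot = is_quot_rat_num_den[of \<phi>]
  have pos: "rat_degree \<phi> > 0" using assms by simp
  note flip = rat_flip_fract[OF quot rat_degree_eq[OF quot, symmetric] pos]
  have "rat_degree (rat_flip \<phi>) \<ge> 2" using rat_degree_eq[OF flip(1)] flip(2) assms by simp
  thus ?thesis
    using assms multiple_fixed_point_deriv[OF flip(1), of 0] Infty
    by (simp add: fixed_multiplicity_def multiplier_def)
qed

section \<open>Lifts preserving a norm up to scaling\<close>

lemma absv_poly_le:
  fixes f :: "'a::nonarch_field poly"
  assumes "\<And>i. absv (coeff f i) \<le> K" "absv t \<le> 1"
  shows "absv (poly f t) \<le> K"
proof -
  have "K \<ge> 0" using assms(1)[of 0] absv_nonneg[of "coeff f 0"] by linarith
  moreover have "absv (coeff f i * t ^ i) \<le> K" for i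
  proof -
    have "absv (coeff f i * t ^ i) \<le> K * 1"
      unfolding absv_mult absv_power using assms \<open>K \<ge> 0\<close>
      by (intro mult_mono power_le_one) (auto simp: absv_nonneg)
    thus ?thesis by simp
  qed
  ultimately show ?thesis unfolding poly_altdef by (intro absv_sum_le) auto
qed

lemma matrix_apply_eq_0:
  assumes "invertible (A :: 'a::field^2^2)" "A *v v = 0"
  shows "v = 0"
  using matrix_inv_cancel(2)[OF assms(1), of v] assms(2) by simp

lemma det2_matrix: "det2 (A *v v) (A *v w) = (A$1$1 * A$2$2 - A$1$2 * A$2$1) * det2 v w"
  by (simp add: det2_def matrix_vector_mult_2 algebra_simps)

text \<open>A linear form vanishing at \<open>x\<close> is a multiple of \<open>det2 x\<close>,
  since its coefficient vector turned by a right angle is parallel to \<open>x\<close>.\<close>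

lemma matrix_row_det2:
  fixes M :: "'a::field^2^2"
  assumes "x \<noteq> 0" "(M *v x)$i = 0"
  shows "\<exists>\<alpha>. \<forall>v. (M *v v)$i = \<alpha> * det2 x v"
proof -
  have "det2 x (vector [- (M$i$2), M$i$1]) = 0"
    using assms(2) by (simp add: det2_def matrix_vector_mult_2 algebra_simps)
  then obtain c where c: "vector [- (M$i$2), M$i$1] = c *s x"
    using det2_eq_0_iff[OF assms(1)] by blast
  hence "- (M$i$2) = c * x$1" and 1: "M$i$1 = c * x$2" by (auto simp: vec2_eq_iff)
  hence "M$i$2 = - (c * x$1)" by (metis minus_minus)
  hence "(M *v v)$i = - c * det2 x v" for v
    using 1 by (simp add: matrix_vector_mult_2 det2_def algebra_simps)
  thus ?thesis by blast
qed

lemma matrix_vec_linear: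
  "(A :: 'a::field^2^2) *v (v + w) = A *v v + A *v w" "A *v (c *s v) = c *s (A *v v)"
  by (simp_all add: vec2_eq_iff matrix_vector_mult_2 algebra_simps)

lemma invertible_imp_nonzero_det:
  assumes "invertible (A :: 'a::field^2^2)"
  shows "A$1$1 * A$2$2 - A$1$2 * A$2$1 \<noteq> 0"
  using assms by (simp add: invertible_det_nz det_2)

text \<open>The norm identity of \<open>good_reduction_pgl_conj_iff\<close> for fixed
  \<open>A\<close> and \<open>C\<close>; the map itself stays in its original coordinate.\<close>

locale good_lift =
  fixes d :: nat and f g :: "'a::{alg_closed_field, nonarch_field} poly"
    and A :: "'a^2^2" and C :: real
  assumes d_pos: "d > 0" and nondeg: "nondeg d f g"
    and A: "invertible A" and C_pos: "C > 0"
    and norm_lift: "vnorm (A *v hlift d f g v) = C * vnorm (A *v v) ^ d"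
begin

abbreviation T :: "'a^2 \<Rightarrow> 'a^2" where "T \<equiv> hlift d f g"

definition N :: "'a^2 \<Rightarrow> real" where "N v = vnorm (A *v v)"

definition D :: real where "D = absv (A$1$1 * A$2$2 - A$1$2 * A$2$1)"

text \<open>For points, this says that they have the same reduction in the coordinate given by \<open>A\<close>.\<close>

definition near :: "'a^2 \<Rightarrow> 'a^2 \<Rightarrow> bool" where "near v w \<longleftrightarrow> D * absv (det2 v w) < N v * N w"

lemma N_lift: "N (T v) = C * N v ^ d"
  by (simp add: N_def norm_lift)

lemma N_pos: "v \<noteq> 0 \<Longrightarrow> N v > 0"
  unfolding N_def using matrix_apply_eq_0[OF A] by (intro vnorm_pos) blast

lemma N_scale: "N (c *s v) = absv c * N v"
  by (simp add: N_def matrix_vec_linear vnorm_scale)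

lemma N_add: "N (v + w) \<le> max (N v) (N w)"
  by (simp add: N_def matrix_vec_linear vnorm_add)

lemma D_pos: "D > 0"
  unfolding D_def using invertible_imp_nonzero_det[OF A] by (rule absv_pos)

lemma det_le: "D * absv (det2 v w) \<le> N v * N w"
  using absv_det2_le[of "A *v v" "A *v w"] by (simp add: det2_matrix absv_mult D_def N_def)

lemma near_scale: "c \<noteq> 0 \<Longrightarrow> near (c *s v) w \<longleftrightarrow> near v w" "c \<noteq> 0 \<Longrightarrow> near v (c *s w) \<longleftrightarrow> near v w"
  unfolding near_def N_scale det2_scale absv_mult using absv_pos[of c] by (simp_all add: mult.left_commute)

lemma T_nonzero: "v \<noteq> 0 \<Longrightarrow> T v \<noteq> 0"
  using nondegD(3)[OF nondeg] by blast

lemma complement_exists: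
  assumes "v \<noteq> 0"
  obtains w where "w \<noteq> 0" "N w = N v" "D * absv (det2 v w) = N v * N v"
proof -
  obtain u where u: "u \<noteq> 0" "vnorm u = 1" "absv (det2 (A *v v) u) = vnorm (A *v v)"
    using orthogonal_vec_exists .
  define w where "w = matrix_inv A *v u"
  have Aw: "A *v w = u" by (simp add: w_def matrix_inv_cancel[OF A])
  have w: "N w = 1" "D * absv (det2 v w) = N v"
    using u det2_matrix[of A v w] by (simp_all add: Aw N_def D_def absv_mult)
  \<comment> \<open>A coordinate of \<open>A *v v\<close> realizing the norm: it rescales
    \<open>w\<close> within the field to the norm of \<open>v\<close>.\<close>
  define c where "c = (if absv ((A *v v)$1) \<ge> absv ((A *v v)$2) then (A *v v)$1 else (A *v v)$2)"
  have c: "absv c = N v" by (auto simp: c_def N_def vnorm_def)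
  have "w \<noteq> 0" using Aw u by auto
  moreover have "c \<noteq> 0" using c N_pos[OF assms] by auto
  ultimately have "c *s w \<noteq> 0" by (auto simp: vec2_eq_0_iff)
  moreover have "D * absv (det2 v (c *s w)) = N v * (D * absv (det2 v w))"
    by (simp add: det2_scale absv_mult c)
  ultimately show thesis using w c by (intro that[of "c *s w"]) (simp_all add: N_scale)
qed

text \<open>Orthogonality of \<open>v\<close> and \<open>w\<close> controls the Cramer coefficients.
  Nearness makes the component along \<open>w\<close> strictly smaller than \<open>N v'\<close>, so
  the component along \<open>v\<close> carries the norm and its coefficient can be factored
  out.\<close>

lemma near_decomposition:
  assumes v: "v \<noteq> 0" and w: "N w = N v" "D * absv (det2 v w) = N v * N v" and near: "near v v'"
  obtains s \<tau> where "s \<noteq> 0" "absv \<tau> < 1" "v' = s *s (v + \<tau> *s w)" "N v' = absv s * N v"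
proof -
  have r: "N v > 0" using N_pos[OF v] .
  have dvw: "det2 v w \<noteq> 0" using w r by auto
  define s t where "s = det2 v' w / det2 v w" and "t = det2 v v' / det2 v w"
  have v': "v' = s *s v + t *s w"
    using det2_cramer[of v w v'] dvw by (simp add: vec2_eq_iff s_def t_def field_simps)
  have "absv t * (N v * N v) = D * absv (det2 v v')"
    unfolding w(2)[symmetric] t_def absv_divide using absv_pos[OF dvw] by simp
  also have "\<dots> < N v * N v'" using near by (simp add: near_def)
  finally have t: "absv t * N v < N v'"
    using r by (simp add: mult.left_commute[of _ "N v"])
  have "N v' \<le> max (absv s * N v) (absv t * N v)"
    using N_add[of "s *s v" "t *s w"] by (simp add: v' N_scale w)
  hence le: "N v' \<le> absv s * N v" using t by auto
  have "s *s v = v' + (- t) *s w" by (simp add: v' vec2_eq_iff)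
  hence "absv s * N v \<le> max (N v') (absv t * N v)"
    using N_add[of v' "(- t) *s w"] by (metis N_scale absv_minus w(1))
  hence eq: "N v' = absv s * N v" using le t by auto
  hence ts: "absv t < absv s" using t r by simp
  hence "s \<noteq> 0" using absv_nonneg[of t] by auto
  show thesis
  proof (rule that[of s "t / s"])
    show "absv (t / s) < 1" using ts absv_pos[OF \<open>s \<noteq> 0\<close>] by (simp add: absv_divide)
    show "v' = s *s (v + (t / s) *s w)" using \<open>s \<noteq> 0\<close> v' by (simp add: vec2_eq_iff field_simps)
  qed fact+
qed

text \<open>On the unit disk \<open>v + t *s w\<close> has norm at most \<open>N v\<close>, which
  bounds the values of the polynomial; \<open>absv_coeff_le\<close> turns this into a bound for its
  coefficients.\<close>

lemma coeff_line_poly_le: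
  assumes w: "N w = N v"
  shows "absv (coeff (line_poly d f g u v w) i) \<le> N u * (C * N v ^ d) / D"
proof (rule absv_coeff_le)
  fix t :: 'a assume t: "absv t \<le> 1"
  have nn: "N x \<ge> 0" for x by (simp add: N_def vnorm_nonneg)
  have "absv t * N v \<le> N v" using mult_right_mono[OF t nn[of v]] by simp
  hence "N (v + t *s w) \<le> N v"
    using N_add[of v "t *s w"] by (simp add: N_scale w)
  hence "N (T (v + t *s w)) \<le> C * N v ^ d"
    unfolding N_lift using C_pos nn by (intro mult_left_mono power_mono) auto
  hence "N u * N (T (v + t *s w)) \<le> N u * (C * N v ^ d)"
    using nn by (intro mult_left_mono) auto
  hence "D * absv (poly (line_poly d f g u v w) t) \<le> N u * (C * N v ^ d)"
    unfolding poly_line_poly using det_le[of u "T (v + t *s w)"] by linarith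
  thus "absv (poly (line_poly d f g u v w) t) \<le> N u * (C * N v ^ d) / D"
    using D_pos by (simp add: field_simps)
qed

text \<open>The lift respects residue classes: the polynomial t -> det (T v, T (v + t w)) has no
  constant term, so on the open unit disk it stays strictly below the bound for its
  coefficients.\<close>

lemma near_lift:
  assumes v: "v \<noteq> 0" and near: "near v v'"
  shows "near (T v) (T v')"
proof -
  obtain w where w: "w \<noteq> 0" "N w = N v" "D * absv (det2 v w) = N v * N v"
    using complement_exists[OF v] .
  obtain s \<tau> where s: "s \<noteq> 0" "absv \<tau> < 1" "v' = s *s (v + \<tau> *s w)" "N v' = absv s * N v"
    using near_decomposition[OF v w(2,3) near] .
  let ?L = "line_poly d f g (T v) v w" and ?K = "N (T v) * (C * N v ^ d) / D"
  have "poly ?L 0 = 0" by (simp add: poly_line_poly)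
  then obtain q where q: "?L = pCons 0 q" by (cases ?L) auto
  have "absv (coeff q i) \<le> ?K" for i
    using coeff_line_poly_le[OF w(2), of "T v" "Suc i"] by (simp add: q)
  hence "absv (poly q \<tau>) \<le> ?K" using s(2) by (intro absv_poly_le) auto
  have K: "?K > 0" using N_pos[OF T_nonzero[OF v]] N_pos[OF v] C_pos D_pos by simp
  have "absv (poly ?L \<tau>) < ?K"
  proof -
    have "absv (poly ?L \<tau>) = absv \<tau> * absv (poly q \<tau>)" by (simp add: q absv_mult)
    also have "\<dots> \<le> absv \<tau> * ?K" by (intro mult_left_mono absv_nonneg) fact
    also have "\<dots> < 1 * ?K" using s(2) K by (intro mult_strict_right_mono)
    finally show ?thesis by simp
  qed
  hence "D * absv (det2 (T v) (T (v + \<tau> *s w))) < N (T v) * (C * N v ^ d)"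
    unfolding poly_line_poly using D_pos by (simp add: field_simps)
  also have "N (v + \<tau> *s w) = N v"
    using s(4) s(1) absv_pos[OF s(1)] by (simp add: s(3) N_scale)
  hence "N (T v) * (C * N v ^ d) = N (T v) * N (T (v + \<tau> *s w))" by (simp add: N_lift)
  finally have "near (T v) (T (v + \<tau> *s w))" unfolding near_def .
  thus ?thesis using s(1) by (simp add: s(3) hlift_scale near_scale)
qed

text \<open>
  The bound \<open>K\<close> for all coefficients is the size of the linear one in the indifferent case, so
  the linear term dominates on the open unit disk iff \<open>v\<close> is indifferent.
\<close>

lemma fixed_line:
  assumes v: "v \<noteq> 0" and mult: "line_multiplier d f g v \<kappa>"
  obtains w K q where "N w = N v" "D * absv (det2 v w) = N v * N v"
    "K = C * N v ^ (d + 1) / D" "K > 0"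
    "line_poly d f g v v w = pCons 0 q" "absv (coeff q 0) = absv \<kappa> * K" "\<And>i. absv (coeff q i) \<le> K"
proof -
  obtain w where w: "w \<noteq> 0" "N w = N v" "D * absv (det2 v w) = N v * N v"
    using complement_exists[OF v] .
  obtain \<mu> where \<mu>: "\<mu> \<noteq> 0" "T v = \<mu> *s v"
    "coeff (line_poly d f g v v w) (Suc 0) = \<kappa> * \<mu> * det2 v w"
    using mult by (auto simp: line_multiplier_def)
  define K where "K = C * N v ^ (d + 1) / D"
  have r: "N v > 0" using N_pos[OF v] .
  \<comment> \<open>Computing the norm of \<open>T v\<close> in two ways gives |\<mu>|, so the
    coefficient bound \<open>K\<close> is exactly |\<mu> det (v, w)|.\<close>
  have "absv \<mu> * N v = C * N v ^ d" using N_lift[of v] by (simp add: \<mu>(2) N_scale)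
  moreover have "absv (det2 v w) = N v * N v / D" using w(3) D_pos by (simp add: field_simps)
  ultimately have K: "absv \<mu> * absv (det2 v w) = K"
    by (simp add: K_def)
  have "poly (line_poly d f g v v w) 0 = 0" by (simp add: poly_line_poly \<mu>(2) det2_scale)
  then obtain q where q: "line_poly d f g v v w = pCons 0 q" by (cases "line_poly d f g v v w") auto
  show thesis
  proof (rule that[OF w(2,3) K_def _ q])
    show "K > 0" using r C_pos D_pos by (simp add: K_def)
    show "absv (coeff q 0) = absv \<kappa> * K"
      using \<mu>(3) by (simp add: q absv_mult mult.assoc flip: K)
    show "absv (coeff q i) \<le> K" for i
      using coeff_line_poly_le[OF w(2), of v "Suc i"] by (simp add: q K_def algebra_simps)
  qed
qed

lemma multiplier_le_1:
  assumes "v \<noteq> 0" "line_multiplier d f g v \<kappa>"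
  shows "absv \<kappa> \<le> 1"
proof (rule fixed_line[OF assms])
  fix K q assume K: "K > 0" and q: "absv (coeff q 0) = absv \<kappa> * K" "\<And>i. absv (coeff q i) \<le> K"
  from q(1) q(2)[of 0] have "absv \<kappa> * K \<le> 1 * K" by simp
  thus "absv \<kappa> \<le> 1" using K by (simp only: mult_le_cancel_right_pos)
qed

text \<open>The constant coefficient of \<open>q\<close> has size \<open>K\<close> and outweighs the
  rest on the open unit disk. So the preimage condition, \<tau> q(\<tau>) = 0, leaves only \<tau> =
  0.\<close>

lemma near_indifferent:
  assumes v: "v \<noteq> 0" and mult: "line_multiplier d f g v \<kappa>" "absv \<kappa> = 1"
    and near: "near v v'" and preimage: "det2 v (T v') = 0"
  shows "det2 v v' = 0"
proof -
  obtain w K q where w: "N w = N v" "D * absv (det2 v w) = N v * N v"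
    and "K = C * N v ^ (d + 1) / D" and K: "K > 0"
    and q: "line_poly d f g v v w = pCons 0 q" "absv (coeff q 0) = absv \<kappa> * K"
    "\<And>i. absv (coeff q i) \<le> K"
    by (rule fixed_line[OF v mult(1)]) blast
  obtain s \<tau> where s: "s \<noteq> 0" "absv \<tau> < 1" "v' = s *s (v + \<tau> *s w)" "N v' = absv s * N v"
    using near_decomposition[OF v w near] .
  obtain c q' where q': "q = pCons c q'" by (cases q)
  have "absv (coeff q' i) \<le> K" for i using q(3)[of "Suc i"] by (simp add: q')
  hence "absv (poly q' \<tau>) \<le> K" using s(2) by (intro absv_poly_le) auto
  hence "absv (\<tau> * poly q' \<tau>) \<le> absv \<tau> * K"
    by (simp add: absv_mult absv_nonneg mult_left_mono)
  also have "\<dots> < 1 * K" using s(2) K by (intro mult_strict_right_mono)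
  finally have "absv (c + \<tau> * poly q' \<tau>) = K"
    using q(2) mult(2) absv_add_eq[of "\<tau> * poly q' \<tau>" c] by (simp add: q')
  hence "poly q \<tau> \<noteq> 0" using K by (auto simp: q')
  moreover have "\<tau> * poly q \<tau> = 0"
    using preimage s(1) poly_line_poly[of d f g v v w \<tau>] by (simp add: s(3) hlift_scale det2_scale q(1))
  ultimately have "\<tau> = 0" by simp
  thus ?thesis by (simp add: s(3) det2_scale)
qed

text \<open>If \<open>u\<close> on the line is fixed with eigenvalue \<nu>, then \<tau> q(\<tau>) =
  \<nu> \<tau> det (v, w). Dividing by \<tau> gives |q(\<tau>)| = \<open>K\<close>, whereas
  |\<kappa>| < 1 makes |q(\<tau>)| smaller.\<close>

lemma near_attracting:
  assumes v: "v \<noteq> 0" and mult: "line_multiplier d f g v \<kappa>" "absv \<kappa> < 1"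
    and near: "near v v'" and v': "v' \<noteq> 0" and fixed: "T v' = \<mu> *s v'"
  shows "det2 v v' = 0"
proof (rule ccontr)
  assume nz: "det2 v v' \<noteq> 0"
  obtain w K q where w: "N w = N v" "D * absv (det2 v w) = N v * N v"
    and K_eq: "K = C * N v ^ (d + 1) / D" and K: "K > 0"
    and q: "line_poly d f g v v w = pCons 0 q" "absv (coeff q 0) = absv \<kappa> * K"
    "\<And>i. absv (coeff q i) \<le> K"
    by (rule fixed_line[OF v mult(1)]) blast
  obtain s \<tau> where s: "s \<noteq> 0" "absv \<tau> < 1" "v' = s *s (v + \<tau> *s w)" "N v' = absv s * N v"
    using near_decomposition[OF v w near] .
  define u where "u = v + \<tau> *s w"
  have r: "N v > 0" using N_pos[OF v] .
  have Nu: "N u = N v" using s(4) absv_pos[OF s(1)] by (simp add: s(3) N_scale u_def)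
  have du: "det2 v u = \<tau> * det2 v w" by (simp add: u_def det2_add_right det2_scale)
  have "\<tau> \<noteq> 0" using nz by (auto simp: s(3) det2_scale)
  \<comment> \<open>Homogeneity moves the fixed-line property from \<open>v'\<close> to its
    normalization \<open>u\<close>.\<close>
  have "s ^ d *s T u = (\<mu> * s) *s u"
    using fixed by (simp add: s(3) u_def[symmetric] hlift_scale vec2_eq_iff mult.assoc)
  hence Tu: "T u = (\<mu> * s / s ^ d) *s u" using s(1) by (simp add: vec2_eq_iff field_simps)
  define \<nu> where "\<nu> = \<mu> * s / s ^ d"
  have \<nu>: "absv \<nu> * N v = C * N v ^ d" using N_lift[of u] by (simp add: Tu N_scale Nu flip: \<nu>_def)
  obtain c q' where q': "q = pCons c q'" by (cases q)
  have "absv (coeff q' i) \<le> K" for i using q(3)[of "Suc i"] by (simp add: q')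
  hence "absv (poly q' \<tau>) \<le> K" using s(2) by (intro absv_poly_le) auto
  hence "absv (\<tau> * poly q' \<tau>) \<le> absv \<tau> * K"
    by (simp add: absv_mult absv_nonneg mult_left_mono)
  also have "\<dots> < 1 * K" using s(2) K by (intro mult_strict_right_mono)
  finally have "absv (\<tau> * poly q' \<tau>) < K" by simp
  moreover have "absv c < K" using q(2) mult(2) K by (simp add: q')
  ultimately have "absv (poly q \<tau>) < K"
    using absv_add_le_max[of c "\<tau> * poly q' \<tau>"] by (simp add: q')
  moreover have "\<tau> * poly q \<tau> = \<nu> * (\<tau> * det2 v w)"
    using poly_line_poly[of d f g v v w \<tau>] Tu by (simp add: q(1) det2_scale du flip: u_def \<nu>_def)
  hence "poly q \<tau> = \<nu> * det2 v w" using \<open>\<tau> \<noteq> 0\<close> by simp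
  moreover have "D * (absv \<nu> * absv (det2 v w)) = (absv \<nu> * N v) * N v"
    using w(2) by (simp add: mult.left_commute mult.assoc)
  hence "absv \<nu> * absv (det2 v w) = K" using D_pos \<nu> by (simp add: K_eq field_simps)
  ultimately show False by (simp add: absv_mult)
qed

text \<open>
  If the three points have distinct reductions in the coordinate given by \<open>A\<close>, then \<open>M\<close> differs
  from \<open>A\<close> by an element of \<open>GL\<^sub>2\<close> of the ring of integers, up to scaling.
\<close>

lemma good_transfer:
  assumes nz: "v1 \<noteq> 0" "v2 \<noteq> 0" "v3 \<noteq> 0"
    and far: "\<not> near v1 v2" "\<not> near v1 v3" "\<not> near v2 v3"
    and M: "invertible M" "(M *v v1)$1 = 0" "(M *v v2)$1 = (M *v v2)$2" "(M *v v3)$2 = 0"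
  shows "\<exists>C'>0. \<forall>v. vnorm (M *v T v) = C' * vnorm (M *v v) ^ d"
proof -
  have eq: "D * absv (det2 v1 v2) = N v1 * N v2" "D * absv (det2 v1 v3) = N v1 * N v3"
    "D * absv (det2 v2 v3) = N v2 * N v3"
    using far det_le[of v1 v2] det_le[of v1 v3] det_le[of v2 v3] by (simp_all add: near_def)
  note r = N_pos[OF nz(1)] N_pos[OF nz(2)] N_pos[OF nz(3)]
  obtain \<alpha> where \<alpha>: "\<And>v. (M *v v)$1 = \<alpha> * det2 v1 v" using matrix_row_det2[OF nz(1) M(2)] by blast
  obtain \<beta> where \<beta>: "\<And>v. (M *v v)$2 = \<beta> * det2 v3 v" using matrix_row_det2[OF nz(3) M(4)] by blast
  have "M *v v3 \<noteq> 0" using matrix_apply_eq_0[OF M(1)] nz by blast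
  hence "\<alpha> \<noteq> 0" using \<alpha>[of v3] M(4) by (auto simp: vec2_eq_0_iff)
  \<comment> \<open>The middle point \<open>v2\<close> forces both rows of \<open>M\<close> to the
    same scale \<kappa>; then \<open>\<kappa> / D\<close> is the ratio of the two norms.\<close>
  define \<kappa> where "\<kappa> = absv \<alpha> * N v1"
  have "\<kappa> > 0" using absv_pos[OF \<open>\<alpha> \<noteq> 0\<close>] r by (simp add: \<kappa>_def)
  have "absv \<alpha> * absv (det2 v1 v2) = absv \<beta> * absv (det2 v3 v2)"
    using M(3) by (simp add: \<alpha> \<beta> flip: absv_mult)
  hence "absv \<alpha> * (D * absv (det2 v1 v2)) = absv \<beta> * (D * absv (det2 v2 v3))"
    by (simp add: det2_swap[of v3 v2] mult.left_commute)
  hence \<kappa>': "\<kappa> = absv \<beta> * N v3" using r by (simp add: eq \<kappa>_def)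
  have sim: "vnorm (M *v v) = \<kappa> / D * N v" for v
  proof (rule antisym)
    have le: "absv \<alpha> * absv (det2 v1 v) \<le> \<kappa> / D * N v" "absv \<beta> * absv (det2 v3 v) \<le> \<kappa> / D * N v"
      using mult_left_mono[OF det_le[of v1 v] absv_nonneg[of \<alpha>]]
        mult_left_mono[OF det_le[of v3 v] absv_nonneg[of \<beta>]] D_pos
      by (simp add: \<kappa>_def field_simps, simp add: \<kappa>' field_simps)
    thus "vnorm (M *v v) \<le> \<kappa> / D * N v" by (simp add: vnorm_def \<alpha> \<beta> absv_mult)
    \<comment> \<open>Cramer's rule in the basis \<open>v1\<close>, \<open>v3\<close>, orthogonal
      since the two are not near, gives the lower bound.\<close>
    have "absv (det2 v1 v3) * N v \<le> max (absv (det2 v v3) * N v1) (absv (det2 v1 v) * N v3)"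
      using N_add[of "det2 v v3 *s v1" "det2 v1 v *s v3"] det2_cramer[of v1 v3 v]
      by (simp flip: N_scale)
    hence "absv (det2 v1 v3) * N v \<le> absv (det2 v3 v) * N v1 \<or>
           absv (det2 v1 v3) * N v \<le> absv (det2 v1 v) * N v3"
      by (simp add: det2_swap[of v v3] le_max_iff_disj)
    moreover have "absv (det2 v1 v3) = N v1 * N v3 / D" using eq(2) D_pos by (simp add: field_simps)
    ultimately have "N v3 * N v \<le> D * absv (det2 v3 v) \<or> N v1 * N v \<le> D * absv (det2 v1 v)"
      using r D_pos by (simp add: field_simps)
    thus "\<kappa> / D * N v \<le> vnorm (M *v v)"
    proof
      assume "N v3 * N v \<le> D * absv (det2 v3 v)"
      from mult_left_mono[OF this absv_nonneg[of \<beta>]] have "\<kappa> / D * N v \<le> absv ((M *v v)$2)"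
        using D_pos by (simp add: \<beta> absv_mult \<kappa>' field_simps)
      thus ?thesis by (simp add: vnorm_def)
    next
      assume "N v1 * N v \<le> D * absv (det2 v1 v)"
      from mult_left_mono[OF this absv_nonneg[of \<alpha>]] have "\<kappa> / D * N v \<le> absv ((M *v v)$1)"
        using D_pos by (simp add: \<alpha> absv_mult \<kappa>_def field_simps)
      thus ?thesis by (simp add: vnorm_def)
    qed
  qed
  define e where "e = \<kappa> / D"
  have "e > 0" using \<open>\<kappa> > 0\<close> D_pos by (simp add: e_def)
  have "vnorm (M *v T v) = e * C / e ^ d * vnorm (M *v v) ^ d" for v
    unfolding sim e_def[symmetric] N_lift using \<open>e > 0\<close> by (simp add: power_mult_distrib)
  moreover have "e * C / e ^ d > 0" using \<open>e > 0\<close> C_pos by simp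
  ultimately show ?thesis by blast
qed

end

section \<open>Three points determine a coordinate\<close>

lemma pt_eq_simps:
  assumes "u \<noteq> 0"
  shows "pt u = Aff 0 \<longleftrightarrow> u$1 = 0" "pt u = Aff 1 \<longleftrightarrow> u$1 = u$2" "pt u = Infty \<longleftrightarrow> u$2 = 0"
  using assms by (auto simp: pt_def vec2_eq_0_iff)

definition normalizes :: "'a::field pgl2 \<Rightarrow> 'a proj_line \<Rightarrow> 'a proj_line \<Rightarrow> 'a proj_line \<Rightarrow> bool"
  where "normalizes h p1 p2 p3 \<longleftrightarrow>
    pgl_apply h p1 = Aff 0 \<and> pgl_apply h p2 = Aff 1 \<and> pgl_apply h p3 = Infty"

lemma normalizes_iff:
  assumes M: "invertible M" and "v1 \<noteq> 0" "v2 \<noteq> 0" "v3 \<noteq> 0"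
  shows "normalizes (abs_pgl2 M) (pt v1) (pt v2) (pt v3) \<longleftrightarrow>
    (M *v v1)$1 = 0 \<and> (M *v v2)$1 = (M *v v2)$2 \<and> (M *v v3)$2 = 0"
proof -
  have "M *v v1 \<noteq> 0" "M *v v2 \<noteq> 0" "M *v v3 \<noteq> 0"
    using matrix_apply_eq_0[OF M] assms by blast+
  thus ?thesis using assms by (simp add: normalizes_def pgl_apply_pt pt_eq_simps)
qed

lemma abs_pgl2_eq_scale:
  assumes "invertible M" "invertible M'" "c \<noteq> 0" "\<And>v. M' *v v = c *s (M *v v)"
  shows "abs_pgl2 M = abs_pgl2 M'"
proof -
  have "M' $ i $ j = c * M $ i $ j" for i j :: 2
  proof -
    have "j = 1 \<or> j = 2" by (rule exhaust_2)
    thus ?thesis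
      using arg_cong[OF assms(4)[of "vector [1, 0]"], of "\<lambda>v. v$i"]
        arg_cong[OF assms(4)[of "vector [0, 1]"], of "\<lambda>v. v$i"]
      by (auto simp: matrix_vector_mult_2)
  qed
  hence "M' = scale_matrix c M" by (simp add: scale_matrix_def vec_eq_iff)
  hence "pgl_rel M M'" using assms by (auto simp: pgl_rel_def)
  thus ?thesis using Quotient3_rel[OF Quotient3_pgl2, of M M'] by blast
qed

text \<open>The conditions at \<open>p1\<close> and \<open>p3\<close> determine each row up to a
  factor, and \<open>p2\<close> fixes the ratio of the factors; what remains is a scalar.\<close>

lemma ex1_normalizes:
  assumes "p1 \<noteq> p2" "p1 \<noteq> p3" "p2 \<noteq> p3"
  shows "\<exists>!h. normalizes h p1 p2 p3"
proof -
  define v1 v2 v3 where "v1 = vec_of p1" and "v2 = vec_of p2" and "v3 = vec_of p3"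
  have nz: "v1 \<noteq> 0" "v2 \<noteq> 0" "v3 \<noteq> 0" and p: "p1 = pt v1" "p2 = pt v2" "p3 = pt v3"
    by (simp_all add: v1_def v2_def v3_def)
  have d: "det2 v1 v2 \<noteq> 0" "det2 v1 v3 \<noteq> 0" "det2 v3 v2 \<noteq> 0"
    using assms pt_eq_iff[of v1 v2] pt_eq_iff[of v1 v3] pt_eq_iff[of v3 v2] nz by (auto simp: p)
  note iff = normalizes_iff[OF _ nz, folded p]
  \<comment> \<open>The rows are the functionals \<open>det2 v1\<close> and \<open>det2 v3\<close>,
    scaled to agree at \<open>v2\<close>.\<close>
  define M :: "'a^2^2" where "M = vector
    [vector [- (det2 v3 v2 * v1$2), det2 v3 v2 * v1$1], vector [- (det2 v1 v2 * v3$2), det2 v1 v2 * v3$1]]"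
  have M: "(M *v v)$1 = det2 v3 v2 * det2 v1 v" "(M *v v)$2 = det2 v1 v2 * det2 v3 v" for v
    by (simp_all add: M_def matrix_vector_mult_2) (simp_all add: det2_def[of _ v] algebra_simps)
  have "det M = det2 v3 v2 * det2 v1 v2 * det2 v1 v3"
    by (simp add: M_def det_2) (simp add: det2_def[of v1 v3] algebra_simps)
  hence "invertible M" using d by (simp add: invertible_det_nz)
  moreover from this have "normalizes (abs_pgl2 M) p1 p2 p3"
    by (simp add: iff M mult.commute)
  moreover have "h = h'" if hs: "normalizes h p1 p2 p3" "normalizes h' p1 p2 p3" for h h'
  proof -
    have rows: "\<exists>\<alpha> \<beta>. \<alpha> \<noteq> 0 \<and> \<alpha> * det2 v1 v2 = \<beta> * det2 v3 v2 \<and>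
        (\<forall>v. (M *v v)$1 = \<alpha> * det2 v1 v \<and> (M *v v)$2 = \<beta> * det2 v3 v)"
      if M: "invertible M" "normalizes (abs_pgl2 M) p1 p2 p3" for M
    proof -
      have eqs: "(M *v v1)$1 = 0" "(M *v v2)$1 = (M *v v2)$2" "(M *v v3)$2 = 0"
        using M(2) unfolding iff[OF M(1)] by blast+
      obtain \<alpha> where a: "\<And>v. (M *v v)$1 = \<alpha> * det2 v1 v"
        using matrix_row_det2[OF nz(1) eqs(1)] by blast
      obtain \<beta> where b: "\<And>v. (M *v v)$2 = \<beta> * det2 v3 v"
        using matrix_row_det2[OF nz(3) eqs(3)] by blast
      note ab = a b
      moreover have "\<alpha> * det2 v1 v2 = \<beta> * det2 v3 v2" using eqs(2) by (simp only: ab)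
      moreover have "M *v v3 \<noteq> 0" using matrix_apply_eq_0[OF M(1)] nz by blast
      hence "\<alpha> \<noteq> 0" using ab[of v3] by (auto simp: vec2_eq_0_iff)
      ultimately show ?thesis by blast
    qed
    obtain M where M: "invertible M" "h = abs_pgl2 M" by (rule pgl_cases)
    obtain M' where M': "invertible M'" "h' = abs_pgl2 M'" by (rule pgl_cases)
    note MM' = M M'
    obtain \<alpha> \<beta> where ab: "\<alpha> \<noteq> 0" "\<alpha> * det2 v1 v2 = \<beta> * det2 v3 v2"
        "\<And>v. (M *v v)$1 = \<alpha> * det2 v1 v" "\<And>v. (M *v v)$2 = \<beta> * det2 v3 v"
      using rows[OF M(1)] hs(1) unfolding M(2) by blast
    obtain \<alpha>' \<beta>' where ab': "\<alpha>' \<noteq> 0" "\<alpha>' * det2 v1 v2 = \<beta>' * det2 v3 v2"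
        "\<And>v. (M' *v v)$1 = \<alpha>' * det2 v1 v" "\<And>v. (M' *v v)$2 = \<beta>' * det2 v3 v"
      using rows[OF M'(1)] hs(2) unfolding M'(2) by blast
    have \<beta>: "\<beta> = \<alpha> * (det2 v1 v2 / det2 v3 v2)" "\<beta>' = \<alpha>' * (det2 v1 v2 / det2 v3 v2)"
      using ab(2) ab'(2) d(3) by (simp_all add: field_simps)
    have "M' *v v = (\<alpha>' / \<alpha>) *s (M *v v)" for v
      using ab(1) by (simp add: vec2_eq_iff ab(3,4) ab'(3,4) \<beta>)
    thus "h = h'" using MM' ab(1) ab'(1) abs_pgl2_eq_scale[of M M' "\<alpha>' / \<alpha>"] by simp
  qed
  ultimately show ?thesis by blast
qed

section \<open>Preimages and base change\<close>

text \<open>The top coefficient is the value at t = infinity, where the line passes through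
  \<open>w\<close>.\<close>

lemma coeff_line_poly_top: "coeff (line_poly d f g u v w) d = det2 u (hlift d f g w)"
  by (simp add: line_poly_def coeff_form_subst_top det2_def)

text \<open>On the line through \<open>a\<close> and \<open>b\<close> the point at infinity
  \<open>b\<close> is a solution if the top coefficient vanishes; otherwise the polynomial has
  positive degree and a root.\<close>

lemma preimage_exists:
  fixes f g :: "'a::alg_closed_field poly"
  assumes "d > 0"
  obtains v where "v \<noteq> 0" "det2 u (hlift d f g v) = 0"
proof -
  define a b :: "'a^2" where "a = vector [1, 0]" and "b = vector [0, 1]"
  have nz: "b \<noteq> 0" "a + t *s b \<noteq> 0" for t by (simp_all add: vec2_eq_0_iff a_def b_def)
  show thesis
  proof (cases "coeff (line_poly d f g u a b) d = 0")
    case True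
    thus thesis using that[of b] nz by (simp add: coeff_line_poly_top)
  next
    case False
    hence "degree (line_poly d f g u a b) > 0" using assms le_degree by fastforce
    then obtain t where "poly (line_poly d f g u a b) t = 0"
      using alg_closed_imp_poly_has_root by blast
    thus thesis using that[of "a + t *s b"] nz by (simp add: poly_line_poly)
  qed
qed

text \<open>Along a line through \<open>v\<close> the preimage equation has the root t = 0, simple
  because \<kappa> is nonzero. As \<open>d \<ge> 2\<close>, another solution remains, possibly at
  infinity.\<close>

lemma second_preimage_exists:
  fixes f g :: "'a::alg_closed_field poly"
  assumes "d \<ge> 2" "v \<noteq> 0" "line_multiplier d f g v \<kappa>" "\<kappa> \<noteq> 0"
  obtains u where "u \<noteq> 0" "det2 v u \<noteq> 0" "det2 v (hlift d f g u) = 0"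
proof -
  obtain w where w: "det2 v w \<noteq> 0"
  proof (cases "v$1 = 0")
    case True
    thus thesis using that[of "vector [1, 0]"] assms(2) by (simp add: det2_def vec2_eq_0_iff)
  next
    case False
    thus thesis using that[of "vector [0, 1]"] by (simp add: det2_def)
  qed
  obtain \<mu> where \<mu>: "\<mu> \<noteq> 0" "hlift d f g v = \<mu> *s v"
    "coeff (line_poly d f g v v w) (Suc 0) = \<kappa> * \<mu> * det2 v w"
    using assms(3) by (auto simp: line_multiplier_def)
  define L where "L = line_poly d f g v v w"
  obtain c q where q: "L = pCons c q" by (cases L)
  have "poly L 0 = 0" by (simp add: L_def poly_line_poly \<mu>(2) det2_scale)
  hence "c = 0" by (simp add: q)
  show thesis
  proof (cases "coeff L d = 0")
    case True
    moreover have "w \<noteq> 0" using w by auto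
    ultimately show thesis using that[of w] w by (simp add: L_def coeff_line_poly_top)
  next
    case False
    hence "coeff q (d - 1) \<noteq> 0" using assms(1) by (cases d) (simp_all add: q)
    hence "degree q > 0" using assms(1) le_degree by fastforce
    then obtain t where t: "poly q t = 0" using alg_closed_imp_poly_has_root by blast
    have "poly q 0 \<noteq> 0" using \<mu> w assms(4) by (simp add: poly_0_coeff_0 q flip: L_def)
    hence "t \<noteq> 0" using t by auto
    have "poly L t = 0" by (simp add: q \<open>c = 0\<close> t)
    moreover have nz: "det2 v (v + t *s w) \<noteq> 0"
      using w \<open>t \<noteq> 0\<close> by (simp add: det2_add_right det2_scale)
    moreover have "v + t *s w \<noteq> 0" using nz by (metis det2_0(2))
    ultimately show thesis using that[of "v + t *s w"] by (simp add: L_def poly_line_poly)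
  qed
qed

section \<open>Degree under the field extension\<close>

lemma rat_degree_rat_map:
  assumes "is_algebraic_closure \<iota>"
  shows "rat_degree (rat_map \<iota> \<phi>) = rat_degree \<phi>"
proof -
  have hom: "\<iota> 1 = 1" "\<And>x y. \<iota> (x + y) = \<iota> x + \<iota> y" "\<And>x y. \<iota> (x * y) = \<iota> x * \<iota> y"
    using assms by (auto simp: is_algebraic_closure_def)
  have 0: "\<iota> 0 = 0" 
  proof -
    have "\<iota> 0 + \<iota> 0 = \<iota> 0 + 0" using hom(2)[of 0 0] by (simp only: add_0_right)
    thus ?thesis by (rule add_left_imp_eq)
  qed
  have inj: "\<iota> x \<noteq> 0" if "x \<noteq> 0" for x
    using hom(3)[of x "inverse x"] hom(1) that by auto
  have sum: "\<iota> (sum h A) = (\<Sum>a\<in>A. \<iota> (h a))" for h and A :: "nat set"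
    by (induction A rule: infinite_finite_induct) (simp_all add: 0 hom)
  have add: "map_poly \<iota> (p + q) = map_poly \<iota> p + map_poly \<iota> q" for p q
    by (rule poly_eqI) (simp add: coeff_map_poly 0 hom)
  have mult: "map_poly \<iota> (p * q) = map_poly \<iota> p * map_poly \<iota> q" for p q
    by (rule poly_eqI) (simp add: coeff_map_poly 0 hom coeff_mult sum)
  have one: "map_poly \<iota> 1 = 1" by (rule poly_eqI) (simp add: coeff_map_poly 0 hom coeff_1)
  have deg: "degree (map_poly \<iota> p) = degree p" for p
    by (rule degree_map_poly) (use inj in auto)
  \<comment> \<open>A Bezout identity survives the embedding, and so does coprimality.\<close>
  obtain a b where ab: "a * rat_num \<phi> + b * rat_den \<phi> = 1"
    using poly_bezout is_quot_rat_num_den[of \<phi>] by (metis is_quot_def)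
  have eq: "map_poly \<iota> a * map_poly \<iota> (rat_num \<phi>) + map_poly \<iota> b * map_poly \<iota> (rat_den \<phi>) = 1"
    by (simp only: ab one flip: mult add)
  have "coprime (map_poly \<iota> (rat_num \<phi>)) (map_poly \<iota> (rat_den \<phi>))"
  proof (rule coprimeI)
    fix c assume "c dvd map_poly \<iota> (rat_num \<phi>)" "c dvd map_poly \<iota> (rat_den \<phi>)"
    thus "is_unit c" unfolding eq[symmetric] by (intro dvd_add dvd_mult)
  qed
  moreover have "rat_den \<phi> \<noteq> 0" using is_quot_rat_num_den[of \<phi>] by (simp add: is_quot_def)
  hence "map_poly \<iota> (rat_den \<phi>) \<noteq> 0" using inj by (subst map_poly_eq_0_iff) (auto simp: 0)
  ultimately have "is_quot (rat_map \<iota> \<phi>) (map_poly \<iota> (rat_num \<phi>)) (map_poly \<iota> (rat_den \<phi>))"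
    by (simp add: is_quot_def rat_map_def)
  from rat_degree_eq[OF this] show ?thesis by (simp add: deg rat_degree_def)
qed

section \<open>The criterion\<close>

locale rational_map =
  fixes \<Phi> :: "'a::{alg_closed_field, nonarch_field} poly fract" and d :: nat
  assumes degree: "rat_degree \<Phi> = d" and d_ge_2: "d \<ge> 2"
begin

abbreviation f :: "'a poly" where "f \<equiv> rat_num \<Phi>"
abbreviation g :: "'a poly" where "g \<equiv> rat_den \<Phi>"
abbreviation T :: "'a^2 \<Rightarrow> 'a^2" where "T \<equiv> hlift d f g"

lemma d_pos: "d > 0" using d_ge_2 by simp

lemma quot: "is_quot \<Phi> f g" by (rule is_quot_rat_num_den)

lemma max_degree: "max (degree f) (degree g) = d" using rat_degree_eq[OF quot] degree by simp

lemma nondeg: "nondeg d f g"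
  using quot max_degree d_pos by (intro nondegI) (auto simp: is_quot_def)

lemma T_nonzero: "v \<noteq> 0 \<Longrightarrow> T v \<noteq> 0" using nondegD(3)[OF nondeg] by blast

lemma rat_apply_pt_eq_iff:
  assumes "v \<noteq> 0"
  shows "rat_apply \<Phi> (pt v) = p \<longleftrightarrow> det2 (vec_of p) (T v) = 0"
proof -
  have "rat_apply \<Phi> (pt v) = p \<longleftrightarrow> pt (vec_of p) = pt (T v)"
    unfolding rat_apply_pt[OF degree assms] by auto
  also have "\<dots> \<longleftrightarrow> det2 (vec_of p) (T v) = 0" by (rule pt_eq_iff[OF vec_of_nonzero T_nonzero[OF assms]])
  finally show ?thesis .
qed

lemma lift_vec_of:
  assumes "rat_apply \<Phi> y = p"
  obtains c where "c \<noteq> 0" "T (vec_of y) = c *s vec_of p"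
proof -
  have "det2 (vec_of p) (T (vec_of y)) = 0"
    using rat_apply_pt_eq_iff[of "vec_of y" p] assms by simp
  then obtain c where c: "T (vec_of y) = c *s vec_of p"
    using det2_eq_0_iff[OF vec_of_nonzero] by blast
  moreover have "c \<noteq> 0" using T_nonzero[OF vec_of_nonzero[of y]] c by auto
  ultimately show thesis using that by blast
qed

lemma potentially_good_imp_good_lift:
  assumes "potentially_good_reduction \<Phi>"
  obtains A C where "good_lift d f g A C"
proof -
  obtain h where "good_reduction (pgl_conj h \<Phi>)"
    using assms by (auto simp: potentially_good_reduction_def)
  moreover obtain A where A: "invertible A" "h = abs_pgl2 A" by (rule pgl_cases)
  ultimately obtain C where "C > 0" "\<forall>v. vnorm (A *v T v) = C * vnorm (A *v v) ^ d"
    using good_reduction_pgl_conj_iff[OF A(1) quot max_degree d_pos] by blast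
  hence "good_lift d f g A C" using A d_pos nondeg by unfold_locales auto
  thus thesis by (rule that)
qed

lemma repelling_imp_not_potentially_good:
  assumes "repelling \<Phi> p"
  shows "\<not> potentially_good_reduction \<Phi>"
proof
  assume "potentially_good_reduction \<Phi>"
  then obtain A C where "good_lift d f g A C" by (rule potentially_good_imp_good_lift)
  then interpret G: good_lift d f g A C .
  have "absv (multiplier \<Phi> p) \<le> 1"
    using G.multiplier_le_1[OF vec_of_nonzero line_multiplier_multiplier[OF degree d_pos]] assms
    by (simp add: repelling_def)
  with assms show False by (simp add: repelling_def)
qed

lemma good_lift_normalizes:
  assumes "good_lift d f g A C" "normalizes h p1 p2 p3"
    and far: "\<not> good_lift.near A (vec_of p1) (vec_of p2)" "\<not> good_lift.near A (vec_of p1) (vec_of p3)"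
      "\<not> good_lift.near A (vec_of p2) (vec_of p3)"
  shows "good_reduction (pgl_conj h \<Phi>)"
proof -
  interpret G: good_lift d f g A C by fact
  obtain M where M: "invertible M" "h = abs_pgl2 M" by (rule pgl_cases)
  have "normalizes (abs_pgl2 M) (pt (vec_of p1)) (pt (vec_of p2)) (pt (vec_of p3))"
    using assms(2) M by simp
  hence "\<exists>C>0. \<forall>v. vnorm (M *v T v) = C * vnorm (M *v v) ^ d"
    unfolding normalizes_iff[OF M(1) vec_of_nonzero vec_of_nonzero vec_of_nonzero]
    using G.good_transfer[OF vec_of_nonzero vec_of_nonzero vec_of_nonzero far M(1)] by blast
  thus ?thesis using good_reduction_pgl_conj_iff[OF M(1) quot max_degree d_pos] M by simp
qed

lemma indifferent_preimages:
  assumes "indifferent \<Phi> p"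
  shows "\<exists>y1 \<in> rat_apply \<Phi> -` {p} - {p}. \<exists>y2. y2 \<in> rat_apply \<Phi> -` {y1}"
proof -
  have "line_multiplier d f g (vec_of p) (multiplier \<Phi> p)" "multiplier \<Phi> p \<noteq> 0"
    using line_multiplier_multiplier[OF degree d_pos] assms by (auto simp: indifferent_def)
  then obtain u where u: "u \<noteq> 0" "det2 (vec_of p) u \<noteq> 0" "det2 (vec_of p) (T u) = 0"
    using second_preimage_exists[OF d_ge_2 vec_of_nonzero] by blast
  have "pt u \<noteq> p" using pt_eq_iff[OF vec_of_nonzero u(1), of p] u(2) by auto
  hence "pt u \<in> rat_apply \<Phi> -` {p} - {p}" using rat_apply_pt_eq_iff[OF u(1)] u(3) by simp
  moreover obtain v where "v \<noteq> 0" "det2 (vec_of (pt u)) (T v) = 0"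
    using preimage_exists[OF d_pos] .
  hence "pt v \<in> rat_apply \<Phi> -` {pt u}" using rat_apply_pt_eq_iff by simp
  ultimately show ?thesis by blast
qed

text \<open>Both \<open>p\<close> and \<open>y1\<close> map to \<open>p\<close>, so
  \<open>near_indifferent\<close> separates them. If \<open>y2\<close> were near \<open>p\<close> or
  \<open>y1\<close>, then \<open>near_lift\<close> would make its image \<open>y1\<close> near
  \<open>p\<close>, the image of both.\<close>

lemma indifferent_criterion:
  assumes p: "indifferent \<Phi> p" and y: "rat_apply \<Phi> y1 = p" "y1 \<noteq> p" "rat_apply \<Phi> y2 = y1"
    and h: "normalizes h p y1 y2" and good: "potentially_good_reduction \<Phi>"
  shows "good_reduction (pgl_conj h \<Phi>)"
proof -
  obtain A C where A: "good_lift d f g A C" using good by (rule potentially_good_imp_good_lift)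
  then interpret G: good_lift d f g A C .
  have fixed: "rat_apply \<Phi> p = p" and abs1: "absv (multiplier \<Phi> p) = 1"
    using p by (auto simp: indifferent_def is_fixed_point_def)
  have mult: "line_multiplier d f g (vec_of p) (multiplier \<Phi> p)"
    using line_multiplier_multiplier[OF degree d_pos] p by (simp add: indifferent_def)
  obtain c0 where c0: "c0 \<noteq> 0" "T (vec_of p) = c0 *s vec_of p" using lift_vec_of[OF fixed] .
  obtain c1 where c1: "c1 \<noteq> 0" "T (vec_of y1) = c1 *s vec_of p" using lift_vec_of[OF y(1)] .
  obtain c2 where c2: "c2 \<noteq> 0" "T (vec_of y2) = c2 *s vec_of y1" using lift_vec_of[OF y(3)] .
  have far: "\<not> G.near (vec_of p) (vec_of y1)"
  proof
    assume "G.near (vec_of p) (vec_of y1)"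
    moreover have "det2 (vec_of p) (T (vec_of y1)) = 0" by (simp add: c1 det2_scale)
    ultimately have "det2 (vec_of p) (vec_of y1) = 0"
      by (rule G.near_indifferent[OF vec_of_nonzero mult abs1])
    thus False using pt_eq_iff[of "vec_of p" "vec_of y1"] y(2) by simp
  qed
  have "\<not> G.near (vec_of p) (vec_of y2)"
    using G.near_lift[OF vec_of_nonzero, of p "vec_of y2"] c0 c2 far by (auto simp: G.near_scale)
  moreover have "\<not> G.near (vec_of y1) (vec_of y2)"
    using G.near_lift[OF vec_of_nonzero, of y1 "vec_of y2"] c1 c2 far by (auto simp: G.near_scale)
  ultimately show ?thesis using good_lift_normalizes[OF A h] far by blast
qed

lemma attracting_criterion:
  assumes p: "attracting \<Phi> p1" "attracting \<Phi> p2" "attracting \<Phi> p3"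
    and distinct: "p1 \<noteq> p2" "p1 \<noteq> p3" "p2 \<noteq> p3"
    and h: "normalizes h p1 p2 p3" and good: "potentially_good_reduction \<Phi>"
  shows "good_reduction (pgl_conj h \<Phi>)"
proof -
  obtain A C where A: "good_lift d f g A C" using good by (rule potentially_good_imp_good_lift)
  then interpret G: good_lift d f g A C .
  have far: "\<not> G.near (vec_of p) (vec_of q)" if "attracting \<Phi> p" "attracting \<Phi> q" "p \<noteq> q" for p q
  proof
    assume near: "G.near (vec_of p) (vec_of q)"
    have mult: "line_multiplier d f g (vec_of p) (multiplier \<Phi> p)" "absv (multiplier \<Phi> p) < 1"
      using line_multiplier_multiplier[OF degree d_pos] that by (simp_all add: attracting_def)
    have "rat_apply \<Phi> q = q" using that by (simp add: attracting_def is_fixed_point_def)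
    then obtain c where "c \<noteq> 0" "T (vec_of q) = c *s vec_of q" by (rule lift_vec_of)
    with near have "det2 (vec_of p) (vec_of q) = 0"
      by (intro G.near_attracting[OF vec_of_nonzero mult]) auto
    thus False using pt_eq_iff[of "vec_of p" "vec_of q"] that by simp
  qed
  show ?thesis using good_lift_normalizes[OF A h] far p distinct by blast
qed

end

section \<open>Enumerated fixed points\<close>

lemma enumerates_fixed_points_is_fixed:
  assumes "enumerates_fixed_points \<Phi> x" "i \<in> {1..rat_degree \<Phi> + 1}"
  shows "is_fixed_point \<Phi> (x i)"
proof (rule ccontr)
  assume "\<not> is_fixed_point \<Phi> (x i)"
  hence "card {j \<in> {1..rat_degree \<Phi> + 1}. x j = x i} = 0"
    using assms(1) by (auto simp: enumerates_fixed_points_def)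
  hence "{j \<in> {1..rat_degree \<Phi> + 1}. x j = x i} = {}" by (subst (asm) card_eq_0_iff) auto
  with assms(2) show False by blast
qed

lemma enumerates_fixed_points_repeated:
  fixes \<Phi> :: "'a::alg_closed_field poly fract"
  assumes x: "enumerates_fixed_points \<Phi> x" and deg: "rat_degree \<Phi> \<ge> 2"
    and ij: "i \<in> {1..rat_degree \<Phi> + 1}" "j \<in> {1..rat_degree \<Phi> + 1}" "i \<noteq> j" "x i = x j"
  shows "multiplier \<Phi> (x i) = 1"
proof -
  have "card {i, j} \<le> card {k \<in> {1..rat_degree \<Phi> + 1}. x k = x i}"
    using ij by (intro card_mono) auto
  also have "\<dots> = fixed_multiplicity \<Phi> (x i)"
    using x enumerates_fixed_points_is_fixed[OF x ij(1)] by (auto simp: enumerates_fixed_points_def)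
  finally show ?thesis using ij(3) by (intro multiple_fixed_point[OF deg]) simp
qed

theorem mainTheorem1:
  fixes \<iota> :: "'k::field \<Rightarrow> 'a::{alg_closed_field, nonarch_field}"
    and \<phi> :: "'k poly fract"
    and \<Phi> :: "'a poly fract"
    and d :: nat
    and x :: "nat \<Rightarrow> 'a proj_line"
  assumes closure: "is_algebraic_closure \<iota>"
    and degree: "rat_degree \<phi> = d" "d \<ge> 2"
    and \<Phi>: "\<Phi> = rat_map \<iota> \<phi>"
    and fixed_points: "enumerates_fixed_points \<Phi> x"
  shows
    "((\<exists>i\<in>{1..d+1}. repelling \<Phi> (x i)) \<longrightarrow> \<not> potentially_good_reduction \<Phi>) \<and>
     ((\<forall>i\<in>{1..d+1}. \<not> repelling \<Phi> (x i)) \<longrightarrow>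
       (\<forall>i\<in>{1..d+1}. indifferent \<Phi> (x i) \<longrightarrow>
          (\<exists>y\<^sub>1 \<in> rat_apply \<Phi> -` {x i} - {x i}. \<exists>y\<^sub>2. y\<^sub>2 \<in> rat_apply \<Phi> -` {y\<^sub>1}) \<and>
          (\<forall>y\<^sub>1 \<in> rat_apply \<Phi> -` {x i} - {x i}. \<forall>y\<^sub>2 \<in> rat_apply \<Phi> -` {y\<^sub>1}.
             distinct [x i, y\<^sub>1, y\<^sub>2] \<and>
             (\<exists>!h. pgl_apply h (x i) = Aff 0 \<and> pgl_apply h y\<^sub>1 = Aff 1 \<and> pgl_apply h y\<^sub>2 = Infty) \<and>
             (\<forall>h. pgl_apply h (x i) = Aff 0 \<and> pgl_apply h y\<^sub>1 = Aff 1 \<and> pgl_apply h y\<^sub>2 = Infty \<longrightarrow>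
                (potentially_good_reduction \<Phi> \<longleftrightarrow> good_reduction (pgl_conj h \<Phi>))))) \<and>
       ((\<forall>i\<in>{1..d+1}. \<not> indifferent \<Phi> (x i)) \<longrightarrow>
          (\<forall>i\<in>{1..d+1}. attracting \<Phi> (x i)) \<and>
          distinct [x 1, x 2, x 3] \<and>
          (\<exists>!h. pgl_apply h (x 1) = Aff 0 \<and> pgl_apply h (x 2) = Aff 1 \<and> pgl_apply h (x 3) = Infty) \<and>
          (\<forall>h. pgl_apply h (x 1) = Aff 0 \<and> pgl_apply h (x 2) = Aff 1 \<and> pgl_apply h (x 3) = Infty \<longrightarrow>
             (potentially_good_reduction \<Phi> \<longleftrightarrow> good_reduction (pgl_conj h \<Phi>)))))"
proof -
  have deg: "rat_degree \<Phi> = d" using rat_degree_rat_map[OF closure] degree(1) by (simp add: \<Phi>)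
  interpret rational_map \<Phi> d by unfold_locales (fact deg degree(2))+
  have pgr: "good_reduction (pgl_conj h \<Phi>) \<Longrightarrow> potentially_good_reduction \<Phi>" for h
    by (auto simp: potentially_good_reduction_def)
  have fixed: "is_fixed_point \<Phi> (x i)" if "i \<in> {1..d+1}" for i
    using enumerates_fixed_points_is_fixed[OF fixed_points] that by (simp add: deg)
  show ?thesis
    unfolding normalizes_def[symmetric]
  proof (intro conjI impI ballI allI)
    assume "\<exists>i\<in>{1..d+1}. repelling \<Phi> (x i)"
    thus "\<not> potentially_good_reduction \<Phi>" using repelling_imp_not_potentially_good by blast
  next
    fix i assume "indifferent \<Phi> (x i)"
    thus "\<exists>y1 \<in> rat_apply \<Phi> -` {x i} - {x i}. \<exists>y2. y2 \<in> rat_apply \<Phi> -` {y1}"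
      by (rule indifferent_preimages)
  next
    fix i y1 y2 assume i: "indifferent \<Phi> (x i)"
      and "y1 \<in> rat_apply \<Phi> -` {x i} - {x i}" "y2 \<in> rat_apply \<Phi> -` {y1}"
    hence y: "rat_apply \<Phi> y1 = x i" "y1 \<noteq> x i" "rat_apply \<Phi> y2 = y1" by auto
    \<comment> \<open>\<Phi> sends \<open>x i\<close> and \<open>y1\<close> to \<open>x i\<close>,
      but \<open>y2\<close> to \<open>y1\<close>, which differs from \<open>x i\<close>.\<close>
    moreover have "rat_apply \<Phi> (x i) = x i" using i by (simp add: indifferent_def is_fixed_point_def)
    ultimately show dist: "distinct [x i, y1, y2]" by auto
    thus "\<exists>!h. normalizes h (x i) y1 y2" by (intro ex1_normalizes) auto
    show "potentially_good_reduction \<Phi> \<longleftrightarrow> good_reduction (pgl_conj h \<Phi>)"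
      if "normalizes h (x i) y1 y2" for h
      using indifferent_criterion[OF i y that] pgr by blast
  next
    assume "\<forall>i\<in>{1..d+1}. \<not> repelling \<Phi> (x i)" "\<forall>i\<in>{1..d+1}. \<not> indifferent \<Phi> (x i)"
    hence attr: "attracting \<Phi> (x i)" if "i \<in> {1..d+1}" for i
      using fixed[OF that] that by (force simp: repelling_def indifferent_def attracting_def)
    thus "attracting \<Phi> (x i)" if "i \<in> {1..d+1}" for i using that .
    \<comment> \<open>A repeated point would have multiplier 1 and not be attracting.\<close>
    have "x i \<noteq> x j" if "i \<in> {1..d+1}" "j \<in> {1..d+1}" "i \<noteq> j" for i j
      using enumerates_fixed_points_repeated[OF fixed_points, of i j] attr[OF that(1)] that d_ge_2
      by (auto simp: deg attracting_def)
    \<comment> \<open>The enumeration has at least three entries because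
      \<open>d \<ge> 2\<close>.\<close>
    moreover have mem: "1 \<in> {1..d+1}" "2 \<in> {1..d+1}" "3 \<in> {1..d+1}" using d_ge_2 by auto
    ultimately have dist: "x 1 \<noteq> x 2" "x 1 \<noteq> x 3" "x 2 \<noteq> x 3" by auto
    thus "distinct [x 1, x 2, x 3]" by simp
    show "\<exists>!h. normalizes h (x 1) (x 2) (x 3)" using dist by (rule ex1_normalizes)
    show "potentially_good_reduction \<Phi> \<longleftrightarrow> good_reduction (pgl_conj h \<Phi>)"
      if "normalizes h (x 1) (x 2) (x 3)" for h
      using attracting_criterion[OF attr attr attr dist that] mem pgr by blast
  qed
qed

end
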